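(* Let $d\ge1$ and $\alpha>0$. Assume that $\{c_i\}_{1\le i\le d}\in(0,+\infty)^d$ are such that $\prod_{i=1}^dc_i=1$ and that not all the $c_i$ are equal to $1$. For real $t$ put $A_t=\mathrm{diag}(c_1^{t/2},\ldots,c_d^{t/2})$ and define $$U_4(t)=\prod_{i=1}^d\theta_4(c_i^t\alpha),\qquad U_2(t)=\theta_{A_t(\mathbb Z+1/2)^d}(\alpha)=\prod_{i=1}^d\theta_2(c_i^t\alpha),$$ $$Q(t)=\frac{\theta_{A_t(\mathbb Z+1/2)^d}(\alpha)}{\theta_{A_t\mathbb Z^d}(\alpha)}=\prod_{i=1}^d\frac{\theta_2(c_i^t\alpha)}{\theta_3(c_i^t\alpha)},$$ $$P_{3,4}(t)=\prod_{i=1}^d\theta_3(c_i^t\alpha)\theta_4(c_i^t\alpha),\qquad P_{2,3}(t)=\prod_{i=1}^d\theta_2(c_i^t\alpha)\theta_3(c_i^t\alpha).$$ Then for any $f\in\{U_4,U_2,Q,P_{3,4},P_{2,3}\}$ we have 1. $f'(0)=0$, 2. $f'(t)>0$ for $t<0$, 3. $f'(t)<0$ for $t>0$. In particular, $t=0$ is the only strict maximum of $f$.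
   Context: For $x>0$ the classical Jacobi theta functions are $$\theta_2(x)=\sum_{k\in\mathbb Z}e^{-\pi(k+1/2)^2x},\quad\theta_3(x)=\sum_{k\in\mathbb Z}e^{-\pi k^2x},\quad\theta_4(x)=\sum_{k\in\mathbb Z}(-1)^ke^{-\pi k^2x}.$$ For a countable set $\mathcal C\subset\mathbb R^d$, $\theta_{\mathcal C}(\alpha)=\sum_{p\in\mathcal C}e^{-\pi\alpha|p|^2}$. *)

theory Defs
  imports "HOL-Analysis.Analysis"
begin

text \<open>
  The series below are meant for positive arguments, where those over the integers and over
  lattices converge absolutely; \<^const>\<open>infsum\<close> is 0 on families that are not summable.
\<close>

definition theta2 :: "real \<Rightarrow> real" where
  "theta2 x = (\<Sum>\<^sub>\<infinity>k\<in>(UNIV::int set). exp (- pi * (of_int k + 1/2)\<^sup>2 * x))"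

definition theta3 :: "real \<Rightarrow> real" where
  "theta3 x = (\<Sum>\<^sub>\<infinity>k\<in>(UNIV::int set). exp (- pi * (of_int k)\<^sup>2 * x))"

definition theta4 :: "real \<Rightarrow> real" where
  "theta4 x = (\<Sum>\<^sub>\<infinity>k\<in>(UNIV::int set). (-1) powi k * exp (- pi * (of_int k)\<^sup>2 * x))"

definition theta_set :: "(real ^ 'n) set \<Rightarrow> real \<Rightarrow> real" where
  "theta_set C \<alpha> = (\<Sum>\<^sub>\<infinity>p\<in>C. exp (- pi * \<alpha> * (norm p)\<^sup>2))"

definition int_lattice :: "(real ^ 'n) set" where
  "int_lattice = {x. \<forall>i. x $ i \<in> \<int>}"

definition half_int_lattice :: "(real ^ 'n) set" where
  "half_int_lattice = {x. \<forall>i. \<exists>k::int. x $ i = of_int k + 1/2}"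

definition diag_matrix :: "('n \<Rightarrow> real) \<Rightarrow> real ^ 'n ^ 'n" where
  "diag_matrix a = (\<chi> i j. if i = j then a i else 0)"

definition A_mat :: "real ^ 'n \<Rightarrow> real \<Rightarrow> real ^ 'n ^ 'n" where
  "A_mat c t = diag_matrix (\<lambda>i. (c $ i) powr (t / 2))"

definition U4 :: "real \<Rightarrow> real ^ 'n \<Rightarrow> real \<Rightarrow> real" where
  "U4 \<alpha> c t = (\<Prod>i\<in>UNIV. theta4 ((c $ i) powr t * \<alpha>))"

definition U2 :: "real \<Rightarrow> real ^ 'n \<Rightarrow> real \<Rightarrow> real" where
  "U2 \<alpha> c t = theta_set ((*v) (A_mat c t) ` half_int_lattice) \<alpha>"

definition Q :: "real \<Rightarrow> real ^ 'n \<Rightarrow> real \<Rightarrow> real" where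
  "Q \<alpha> c t = theta_set ((*v) (A_mat c t) ` half_int_lattice) \<alpha> /
             theta_set ((*v) (A_mat c t) ` int_lattice) \<alpha>"

definition P34 :: "real \<Rightarrow> real ^ 'n \<Rightarrow> real \<Rightarrow> real" where
  "P34 \<alpha> c t = (\<Prod>i\<in>UNIV. theta3 ((c $ i) powr t * \<alpha>) * theta4 ((c $ i) powr t * \<alpha>))"

definition P23 :: "real \<Rightarrow> real ^ 'n \<Rightarrow> real \<Rightarrow> real" where
  "P23 \<alpha> c t = (\<Prod>i\<in>UNIV. theta2 ((c $ i) powr t * \<alpha>) * theta3 ((c $ i) powr t * \<alpha>))"

end

theory Submission
  imports Defs "HOL-Library.Nat_Bijection" "HOL-Probability.Distributions"
begin

text \<open>
  Call a positive function \<open>\<phi>\<close> on the positive reals strictly log-concave in the logarithm if \<open>G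
  u = - ln (\<phi> (exp u))\<close> is strictly convex. For such a differentiable \<open>\<phi>\<close> the product of the \<open>\<phi>
  (c\<^sub>i\<^sup>t \<alpha>)\<close> is \<open>exp (- L t)\<close> with \<open>L t = \<Sum>\<^sub>i G (t ln c\<^sub>i + ln \<alpha>)\<close>, and \<open>L' t = \<Sum>\<^sub>i ln c\<^sub>i G' (t
  ln c\<^sub>i + ln \<alpha>)\<close>. Since \<open>G'\<close> is strictly increasing, replacing each argument by \<open>ln \<alpha>\<close> lowers
  the sum for \<open>t > 0\<close> and raises it for \<open>t < 0\<close>; the replaced sum is \<open>G' (ln \<alpha>) \<Sum>\<^sub>i ln c\<^sub>i = 0\<close>
  because the \<open>c\<^sub>i\<close> have product one. This is \<open>prod_scaled_strictly_peaked_at_0\<close>. What remains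
  is the strict log-concavity of \<open>\<theta>\<^sub>4\<close>, \<open>\<theta>\<^sub>2\<close>, \<open>\<theta>\<^sub>2/\<theta>\<^sub>3\<close>, \<open>\<theta>\<^sub>3\<theta>\<^sub>4\<close> and \<open>\<theta>\<^sub>2\<theta>\<^sub>3\<close>. Everything
  rests on the duplication formulas, which are obtained by splitting the lattice \<open>\<int>\<^sup>2\<close> by parity
  (\<open>theta_mult\<close>).

  Convexity of \<open>h u = - ln (\<theta>\<^sub>2/\<theta>\<^sub>3) (exp u)\<close>. Duplication reads \<open>h u = F (h (u + ln 2))\<close> with
  \<open>F y = ln (cosh y) / 2\<close>, which is strictly convex with slopes at most one half, and increasing
  on the positive reals, where \<open>h\<close> takes its values. Hence a failure of convexity of \<open>h\<close> at some
  points is at most half the failure at the points shifted by \<open>ln 2\<close>. Far to the right \<open>h\<close>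
  differs from the convex function \<open>(\<pi>/4) exp u\<close> by a bounded amount, so the failure there is
  bounded, and halving it indefinitely gives zero (\<open>strictly_convex_cosh_recurrence\<close>).

  Functional equation. Duplication of \<open>\<theta>\<^sub>4/\<theta>\<^sub>3\<close> at \<open>x\<close> and of \<open>\<theta>\<^sub>2/\<theta>\<^sub>3\<close> at \<open>1/x\<close> is the same
  recursion, a step of the arithmetic-geometric mean. If \<open>(\<theta>\<^sub>4/\<theta>\<^sub>3) x < (\<theta>\<^sub>2/\<theta>\<^sub>3) (1/x)\<close>, this
  inequality persists under doubling \<open>x\<close>, and comparing the two infinite products for \<open>\<theta>\<^sub>3\<close>,
  normalised by \<open>\<theta>\<^sub>3 \<longlonglongrightarrow> 1\<close> at infinity and \<open>\<surd>y \<theta>\<^sub>3 y \<longlonglongrightarrow> 1\<close> at zero (a Riemann sum for the Gaussian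
  integral), yields \<open>\<theta>\<^sub>3 (1/x)\<^sup>2 < x \<theta>\<^sub>3 x\<^sup>2\<close>. By Jacobi's quartic identity the same holds with
  \<open>1/x\<close> for \<open>x\<close>, which is absurd; the opposite inequality is excluded symmetrically. So
  \<open>(\<theta>\<^sub>4/\<theta>\<^sub>3) x = (\<theta>\<^sub>2/\<theta>\<^sub>3) (1/x)\<close> (\<open>ratio_modular\<close>), and the transformation laws of the three
  theta functions follow.

  The other functions. The law \<open>\<theta>\<^sub>4 (2x)\<^sup>2 = \<theta>\<^sub>3 x \<theta>\<^sub>4 x\<close> writes \<open>- ln \<theta>\<^sub>4\<close> as half the sum of
  \<open>- ln (\<theta>\<^sub>4/\<theta>\<^sub>3)\<close> over \<open>x\<close>, \<open>2x\<close>, \<open>4x\<close>, and so on, each of whose terms is a reflected translate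
  of \<open>h\<close>. The function \<open>\<theta>\<^sub>2\<close> follows by the functional equation, and up to a constant both
  products are squares of \<open>\<theta>\<^sub>4\<close> or \<open>\<theta>\<^sub>2\<close> at a rescaled argument.
\<close>

section \<open>Theta series with shift and sign\<close>

text \<open>
  The three theta functions are the members \<open>(a, s) = (1/2, 1)\<close>, \<open>(0, 1)\<close> and \<open>(0, - 1)\<close>. Shift
  and sign are kept as parameters because products within the family stay in it, so one formula
  covers all duplications.
\<close>

definition theta :: "real \<Rightarrow> real \<Rightarrow> real \<Rightarrow> real" where
  "theta a s x = (\<Sum>\<^sub>\<infinity>k\<in>(UNIV::int set). s powi k * exp (- pi * (of_int k + a)\<^sup>2 * x))"

lemma UNIV_int_split: "(UNIV::int set) = range int \<union> range (\<lambda>n. - 1 - int n)"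
proof -
  have "k \<in> range int \<union> range (\<lambda>n. - 1 - int n)" for k
  proof (cases "k \<ge> 0")
    case True
    then have "k = int (nat k)" by simp
    then show ?thesis by blast
  next
    case False
    then have "k = - 1 - int (nat (- 1 - k))" by simp
    then show ?thesis by blast
  qed
  then show ?thesis by blast
qed

lemma summable_exp_abs_int:
  fixes x :: real
  assumes "x > 0"
  shows "(\<lambda>k::int. exp (- x * \<bar>of_int k\<bar>)) summable_on UNIV"
proof -
  have geo: "summable (\<lambda>n. exp (- x) ^ n)"
    using assms by (simp add: summable_geometric_iff)
  have "(\<lambda>n. exp (- x) ^ n) = (\<lambda>n::nat. exp (- x * real n))"
    by (simp only: exp_of_nat2_mult)
  with geo have nat: "(\<lambda>n::nat. exp (- x * real n)) summable_on UNIV"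
    by (intro summable_nonneg_imp_summable_on) (simp_all only: exp_ge_zero)
  have "(\<lambda>k::int. exp (- x * \<bar>of_int k\<bar>)) summable_on range int"
    using nat by (subst summable_on_reindex) (auto simp: o_def)
  moreover have "(\<lambda>k::int. exp (- x * \<bar>of_int k\<bar>)) summable_on range (\<lambda>n. - 1 - int n)"
  proof (subst summable_on_reindex)
    show "inj (\<lambda>n. - 1 - int n)" by (auto simp: inj_def)
    have "(\<lambda>k::int. exp (- x * \<bar>of_int k\<bar>)) \<circ> (\<lambda>n. - 1 - int n) = (\<lambda>n. exp (- x) * exp (- x * real n))"
      by (auto simp: fun_eq_iff exp_add[symmetric] algebra_simps)
    then show "((\<lambda>k::int. exp (- x * \<bar>of_int k\<bar>)) \<circ> (\<lambda>n. - 1 - int n)) summable_on UNIV"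
      using nat by (simp add: summable_on_cmult_right)
  qed
  ultimately show ?thesis
    unfolding UNIV_int_split by (rule summable_on_Un_disjoint) auto
qed

text \<open>
  The bound \<open>\<bar>k\<bar> \<le> (k + a)\<^sup>2 + 1 + \<bar>a\<bar>\<close> compares the Gaussian with a two-sided geometric series.
\<close>

lemma gaussian_summable_on_int:
  assumes "x > 0"
  shows "(\<lambda>k::int. exp (- pi * (of_int k + a)\<^sup>2 * x)) summable_on UNIV"
proof -
  have "(\<lambda>k::int. norm (exp (- pi * (of_int k + a)\<^sup>2 * x))) summable_on UNIV"
  proof (rule Infinite_Sum.abs_summable_on_comparison_test)
    have "(\<lambda>k::int. exp (pi * x * (1 + \<bar>a\<bar>)) * exp (- (pi * x) * \<bar>of_int k\<bar>)) summable_on UNIV"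
      using assms by (intro summable_on_cmult_right summable_exp_abs_int) simp
    then show "(\<lambda>k::int. norm (exp (pi * x * (1 + \<bar>a\<bar>)) * exp (- (pi * x) * \<bar>of_int k\<bar>))) summable_on UNIV"
      by simp
    fix k :: int
    have "0 \<le> (\<bar>of_int k + a\<bar> - 1/2)\<^sup>2" by simp
    then have "\<bar>of_int k + a\<bar> \<le> (of_int k + a)\<^sup>2 + 1"
      by (simp add: power2_eq_square algebra_simps)
    then have "\<bar>of_int k\<bar> \<le> (of_int k + a)\<^sup>2 + 1 + \<bar>a\<bar>" by linarith
    then have "pi * x * \<bar>of_int k\<bar> \<le> pi * x * ((of_int k + a)\<^sup>2 + 1 + \<bar>a\<bar>)"
      using assms by (intro mult_left_mono) auto
    then show "norm (exp (- pi * (of_int k + a)\<^sup>2 * x))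
        \<le> norm (exp (pi * x * (1 + \<bar>a\<bar>)) * exp (- (pi * x) * \<bar>of_int k\<bar>))"
      by (simp add: exp_add[symmetric] algebra_simps)
  qed
  then show ?thesis by simp
qed

lemma abs_powi_1: "\<bar>s\<bar> = (1::real) \<Longrightarrow> \<bar>s powi k\<bar> = 1"
  by (simp add: power_int_abs)

lemma theta_abs_summable:
  assumes "x > 0" "\<bar>s\<bar> = 1"
  shows "(\<lambda>k. norm (s powi k * exp (- pi * (of_int k + a)\<^sup>2 * x))) summable_on UNIV"
  using gaussian_summable_on_int[OF assms(1), of a] assms(2) by (simp add: abs_mult abs_powi_1)

lemma theta_summable:
  assumes "x > 0" "\<bar>s\<bar> = 1"
  shows "(\<lambda>k. s powi k * exp (- pi * (of_int k + a)\<^sup>2 * x)) summable_on UNIV"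
  by (rule abs_summable_summable[OF theta_abs_summable[OF assms]])

text \<open>
  The pairs with even coordinate sum form the sublattice \<open>(p + q, p - q)\<close>, the others its
  translate by \<open>(1, 0)\<close>.
\<close>

lemma infsum_int_pair_parity:
  fixes f :: "int \<times> int \<Rightarrow> real"
  assumes "f summable_on UNIV"
  shows "infsum f UNIV = (\<Sum>\<^sub>\<infinity>(p,q)\<in>UNIV. f (p + q, p - q)) + (\<Sum>\<^sub>\<infinity>(p,q)\<in>UNIV. f (p + q + 1, p - q))"
proof -
  let ?e = "\<lambda>(p::int,q::int). (p + q, p - q)" and ?o = "\<lambda>(p::int,q::int). (p + q + 1, p - q)"
  have inj: "inj ?e" "inj ?o" by (auto simp: inj_def)
  have "(m, n) \<in> range ?e \<union> range ?o" for m n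
  proof (cases "even (m - n)")
    case True
    then obtain q where "m - n = 2 * q" by (rule evenE)
    then have "(m, n) = ?e (n + q, q)" by simp
    then show ?thesis by blast
  next
    case False
    then obtain q where "m - n = 2 * q + 1" by (rule oddE)
    then have "(m, n) = ?o (n + q, q)" by simp
    then show ?thesis by blast
  qed
  then have U: "UNIV = range ?e \<union> range ?o" by auto
  have disj: "range ?e \<inter> range ?o = {}"
  proof -
    have "even (fst z + snd z)" if "z \<in> range ?e" for z using that by auto
    moreover have "odd (fst z + snd z)" if "z \<in> range ?o" for z using that by auto
    ultimately show ?thesis by blast
  qed
  have "infsum f (range ?e \<union> range ?o) = infsum f (range ?e) + infsum f (range ?o)"
    by (rule infsum_Un_disjoint[OF _ _ disj]; rule summable_on_subset_banach[OF assms]) auto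
  then have "infsum f UNIV = infsum f (range ?e) + infsum f (range ?o)"
    by (simp only: U[symmetric])
  also have "infsum f (range ?e) = (\<Sum>\<^sub>\<infinity>(p,q)\<in>UNIV. f (p + q, p - q))"
    by (subst infsum_reindex[OF inj(1)]) (auto intro!: infsum_cong)
  also have "infsum f (range ?o) = (\<Sum>\<^sub>\<infinity>(p,q)\<in>UNIV. f (p + q + 1, p - q))"
    by (subst infsum_reindex[OF inj(2)]) (auto intro!: infsum_cong)
  finally show ?thesis .
qed

lemma infsum_prod_pair:
  fixes f :: "'a \<Rightarrow> real" and g :: "'b \<Rightarrow> real"
  assumes "(\<lambda>m. norm (f m)) summable_on UNIV" "(\<lambda>n. norm (g n)) summable_on UNIV"
  shows "(\<lambda>(m,n). f m * g n) summable_on UNIV"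
    and "(\<Sum>\<^sub>\<infinity>(m,n)\<in>UNIV. f m * g n) = infsum f UNIV * infsum g UNIV"
proof -
  have abs: "(\<lambda>z. norm (case z of (m,n) \<Rightarrow> f m * g n)) summable_on (UNIV \<times> UNIV)"
    unfolding Infinite_Sum.abs_summable_on_Sigma_iff
    using assms
    by (auto simp: abs_mult infsum_cmult_right' infsum_nonneg
        intro: summable_on_cmult_right summable_on_cmult_left)
  then show s: "(\<lambda>(m,n). f m * g n) summable_on UNIV"
    using abs_summable_summable[OF abs] by simp
  have "(\<Sum>\<^sub>\<infinity>(m,n)\<in>UNIV \<times> UNIV. f m * g n) = (\<Sum>\<^sub>\<infinity>m. \<Sum>\<^sub>\<infinity>n. f m * g n)"
    using s by (subst infsum_Sigma'_banach) auto
  then show "(\<Sum>\<^sub>\<infinity>(m,n)\<in>UNIV. f m * g n) = infsum f UNIV * infsum g UNIV"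
    by (simp add: infsum_cmult_right' infsum_cmult_left')
qed

text \<open>
  The rotation \<open>(p + q)\<^sup>2 + (p - q)\<^sup>2 = 2 p\<^sup>2 + 2 q\<^sup>2\<close> separates the variables again on each
  parity class, at the doubled argument. Signs combine to \<open>s t\<close> in both variables because \<open>t\<^sup>-\<^sup>1
  = t\<close>.
\<close>

lemma theta_mult:
  assumes "x > 0" "\<bar>s\<bar> = 1" "\<bar>t\<bar> = 1"
  shows "theta a s x * theta b t x =
      theta ((a + b) / 2) (s * t) (2 * x) * theta ((a - b) / 2) (s * t) (2 * x) +
      s * (theta ((a + b + 1) / 2) (s * t) (2 * x) * theta ((a - b + 1) / 2) (s * t) (2 * x))"
proof -
  define e where "e = (\<lambda>s a x k. s powi k * exp (- pi * (of_int k + a)\<^sup>2 * x))"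
  have th: "theta a s x = infsum (e s a x) UNIV" for s a x
    by (simp add: theta_def e_def)
  have abs: "(\<lambda>k. norm (e s a x k)) summable_on UNIV" if "x > 0" "\<bar>s\<bar> = 1" for s a x
    unfolding e_def by (rule theta_abs_summable[OF that])
  have x2: "2 * x > 0" and st: "\<bar>s * t\<bar> = 1" using assms by (auto simp: abs_mult)
  have tinv: "inverse t = t" and nz: "s \<noteq> 0" "t \<noteq> 0"
    using assms(2,3) by (auto simp: abs_if split: if_splits)
  have ev: "e s a x (p + q) * e t b x (p - q) =
      e (s * t) ((a + b) / 2) (2 * x) p * e (s * t) ((a - b) / 2) (2 * x) q" for a b p q
  proof -
    have "(of_int (p + q) + a)\<^sup>2 + (of_int (p - q) + b)\<^sup>2 =
        2 * (of_int p + (a + b) / 2)\<^sup>2 + 2 * (of_int q + (a - b) / 2)\<^sup>2"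
      by (simp add: power2_eq_square field_simps)
    then have "- pi * (of_int (p + q) + a)\<^sup>2 * x + - pi * (of_int (p - q) + b)\<^sup>2 * x =
       - pi * (of_int p + (a + b) / 2)\<^sup>2 * (2 * x) + - pi * (of_int q + (a - b) / 2)\<^sup>2 * (2 * x)"
      by algebra
    moreover have "t powi (p - q) = t powi p * t powi q"
      using nz tinv by (simp add: power_int_diff divide_inverse power_int_inverse[symmetric])
    ultimately show ?thesis
      using nz by (simp add: e_def power_int_add power_int_mult_distrib exp_add[symmetric] mult_ac)
  qed
  have od: "e s a x (p + q + 1) * e t b x (p - q) =
      s * (e (s * t) ((a + b + 1) / 2) (2 * x) p * e (s * t) ((a - b + 1) / 2) (2 * x) q)" for p q
  proof -
    have "e s a x (p + q + 1) = s * e s (a + 1) x (p + q)"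
      using nz by (simp add: e_def power_int_add algebra_simps)
    moreover have "e s (a + 1) x (p + q) * e t b x (p - q) =
      e (s * t) ((a + 1 + b) / 2) (2 * x) p * e (s * t) ((a + 1 - b) / 2) (2 * x) q"
      by (rule ev)
    ultimately show ?thesis by (simp add: algebra_simps)
  qed
  have "theta a s x * theta b t x = (\<Sum>\<^sub>\<infinity>(m,n)\<in>UNIV. e s a x m * e t b x n)"
    unfolding th by (rule infsum_prod_pair(2)[symmetric]) (rule abs assms)+
  also have "\<dots> = (\<Sum>\<^sub>\<infinity>(p,q)\<in>UNIV. e s a x (p + q) * e t b x (p - q)) +
      (\<Sum>\<^sub>\<infinity>(p,q)\<in>UNIV. e s a x (p + q + 1) * e t b x (p - q))"
    using infsum_int_pair_parity[OF infsum_prod_pair(1)[OF abs[OF assms(1,2), of a] abs[OF assms(1,3), of b]]]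
    by simp
  also have "\<dots> = theta ((a + b) / 2) (s * t) (2 * x) * theta ((a - b) / 2) (s * t) (2 * x) +
      (\<Sum>\<^sub>\<infinity>(p,q)\<in>UNIV. s * (e (s * t) ((a + b + 1) / 2) (2 * x) p * e (s * t) ((a - b + 1) / 2) (2 * x) q))"
    unfolding ev od th
    by (subst infsum_prod_pair(2)) (rule refl abs x2 st)+
  also have "(\<Sum>\<^sub>\<infinity>(p,q)\<in>UNIV. s * (e (s * t) ((a + b + 1) / 2) (2 * x) p * e (s * t) ((a - b + 1) / 2) (2 * x) q))
     = s * (theta ((a + b + 1) / 2) (s * t) (2 * x) * theta ((a - b + 1) / 2) (s * t) (2 * x))"
    using infsum_prod_pair(2)[OF abs[OF x2 st] abs[OF x2 st]]
    unfolding th case_prod_unfold by (subst infsum_cmult_right') simp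
  finally show ?thesis .
qed

text \<open>
  Termwise differentiation: with \<open>l\<^sub>n = \<pi> (k + a)\<^sup>2\<close>, the derived terms satisfy \<open>l\<^sub>n exp (- l\<^sub>n
  d) \<le> (2/d) exp (- l\<^sub>n d/2)\<close> on \<open>x > d\<close>, which is summable.
\<close>

lemma theta_differentiable:
  assumes "x > 0" "\<bar>s\<bar> = 1"
  shows "theta a s differentiable (at x)"
proof -
  define l where "l = (\<lambda>n. pi * (of_int (int_decode n) + a)\<^sup>2)"
  define f where "f = (\<lambda>n y. s powi (int_decode n) * exp (- l n * y))"
  define f' where "f' = (\<lambda>n y. s powi (int_decode n) * (- l n * exp (- l n * y)))"
  define d where "d = x / 2"
  have d: "d > 0" using assms by (simp add: d_def)
  have l0: "l n \<ge> 0" for n by (simp add: l_def)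
  have sumf: "(\<lambda>n. f n y) summable_on UNIV \<and> infsum (\<lambda>n. f n y) UNIV = theta a s y" if "y > 0" for y
    using theta_summable[OF that assms(2), of a] bij_int_decode
      summable_on_reindex_bij_betw[of int_decode UNIV UNIV "\<lambda>k. s powi k * exp (- pi * (of_int k + a)\<^sup>2 * y)"]
      infsum_reindex_bij_betw[of int_decode UNIV UNIV "\<lambda>k. s powi k * exp (- pi * (of_int k + a)\<^sup>2 * y)"]
    by (simp add: f_def l_def theta_def)
  have sums: "(\<lambda>n. f n y) sums theta a s y" if "y > 0" for y
    using sumf[OF that] has_sum_imp_sums by (metis has_sum_infsum)
  have der: "(f n has_field_derivative f' n y) (at y)" for n y
    unfolding f_def f'_def by (auto intro!: derivative_eq_intros)
  have "uniformly_convergent_on {d<..} (\<lambda>n y. \<Sum>i<n. f' i y)"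
  proof (rule Weierstrass_m_test')
    fix n y assume y: "y \<in> {d<..}"
    have "l n * exp (- l n * y) \<le> l n * exp (- l n * d)"
      using y l0[of n] by (intro mult_left_mono) (auto intro: mult_left_mono)
    also have "\<dots> = 2 / d * (l n * d / 2) * exp (- l n * d)" using d by simp
    also have "\<dots> \<le> 2 / d * exp (l n * d / 2) * exp (- l n * d)"
    proof (intro mult_right_mono mult_left_mono)
      show "l n * d / 2 \<le> exp (l n * d / 2)"
        using exp_ge_add_one_self[of "l n * d / 2"] by linarith
    qed (use d in auto)
    also have "\<dots> = 2 / d * (exp (l n * d / 2) * exp (- l n * d))"
      by (rule mult.assoc)
    also have "exp (l n * d / 2) * exp (- l n * d) = exp (- l n * (d / 2))"
      unfolding exp_add[symmetric] by (rule arg_cong[of _ _ exp]) (simp add: field_simps)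
    finally show "norm (f' n y) \<le> 2 / d * exp (- l n * (d / 2))"
      using l0[of n] by (simp add: f'_def abs_mult abs_powi_1[OF assms(2)])
  next
    have "(\<lambda>n. exp (- l n * (d / 2))) summable_on UNIV"
      using gaussian_summable_on_int[of "d / 2" a] bij_int_decode d
        summable_on_reindex_bij_betw[of int_decode UNIV UNIV "\<lambda>k. exp (- pi * (of_int k + a)\<^sup>2 * (d / 2))"]
      by (simp add: l_def)
    then have "summable (\<lambda>n. exp (- l n * (d / 2)))"
      by (rule summable_on_imp_summable)
    then show "summable (\<lambda>n. 2 / d * exp (- l n * (d / 2)))"
      by (rule summable_mult)
  qed
  then have "(\<lambda>y. \<Sum>n. f n y) differentiable (at x)"
    using sums[OF assms(1)] d
    by (intro differentiable_series'[where S = "{d<..}" and f' = f'])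
      (auto simp: d_def intro: der sums_summable)
  then obtain D where D: "((\<lambda>y. \<Sum>n. f n y) has_real_derivative D) (at x)"
    by (auto simp: real_differentiable_def)
  have "(theta a s has_real_derivative D) (at x)"
    by (rule has_field_derivative_transform_within_open[OF D, of "{0<..}"])
      (use assms(1) sums in \<open>auto simp: sums_iff\<close>)
  then show ?thesis by (auto simp: real_differentiable_def)
qed

section \<open>Duplication formulas\<close>

lemma theta3_eq: "theta3 = theta 0 1"
  by (simp add: fun_eq_iff theta3_def theta_def)

lemma theta4_eq: "theta4 = theta 0 (- 1)"
  by (simp add: fun_eq_iff theta4_def theta_def)

lemma theta2_eq: "theta2 = theta (1/2) 1"
  by (simp add: fun_eq_iff theta2_def theta_def)

lemma theta_one_shift: "theta 1 1 x = theta 0 1 x"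
proof -
  have "bij (\<lambda>k::int. k + 1)"
    by (rule bij_betw_byWitness[where f' = "\<lambda>k. k - 1"]) auto
  from infsum_reindex_bij_betw[OF this, of "\<lambda>k. exp (- pi * (of_int k)\<^sup>2 * x)"]
  show ?thesis by (simp add: theta_def)
qed

text \<open>
  The reflection \<open>k \<mapsto> - 1 - k\<close> fixes the exponent and flips the sign. This vanishing (of \<open>\<theta>\<^sub>1\<close>
  at the origin) is what makes the product of \<open>\<theta>\<^sub>3\<close> and \<open>\<theta>\<^sub>4\<close> a perfect square.
\<close>

lemma theta_half_alternating: "theta (1/2) (- 1) x = 0"
proof -
  let ?e = "\<lambda>k. (- 1) powi k * exp (- pi * (of_int k + 1/2)\<^sup>2 * x)"
  have "bij (\<lambda>k::int. - 1 - k)"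
    by (rule bij_betw_byWitness[where f' = "\<lambda>k. - 1 - k"]) auto
  from infsum_reindex_bij_betw[OF this, of ?e]
  have "theta (1/2) (- 1) x = (\<Sum>\<^sub>\<infinity>k. ?e (- 1 - k))"
    by (simp add: theta_def)
  also have "\<dots> = (\<Sum>\<^sub>\<infinity>k. - ?e k)"
  proof (rule infsum_cong)
    fix k :: int
    have "(of_int (- 1 - k) + 1/2 :: real)\<^sup>2 = (of_int k + 1/2)\<^sup>2"
      by (simp add: power2_eq_square field_simps)
    moreover have "(- 1 :: real) powi (- 1 - k) = - ((- 1) powi k)"
      by (auto simp: power_int_minus_left)
    ultimately show "?e (- 1 - k) = - ?e k" by simp
  qed
  also have "\<dots> = - theta (1/2) (- 1) x"
    by (simp add: theta_def infsum_uminus)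
  finally show ?thesis by simp
qed

context
  fixes x :: real
  assumes x: "x > 0"
begin

lemma theta3_sq: "(theta3 x)\<^sup>2 = (theta3 (2 * x))\<^sup>2 + (theta2 (2 * x))\<^sup>2"
  using theta_mult[OF x, of 1 1 0 0] by (simp add: theta3_eq theta2_eq power2_eq_square)

lemma theta4_sq: "(theta4 x)\<^sup>2 = (theta3 (2 * x))\<^sup>2 - (theta2 (2 * x))\<^sup>2"
  using theta_mult[OF x, of "-1" "-1" 0 0]
  by (simp add: theta3_eq theta2_eq theta4_eq power2_eq_square)

lemma theta3_theta4: "theta3 x * theta4 x = (theta4 (2 * x))\<^sup>2"
  using theta_mult[OF x, of 1 "-1" 0 0]
  by (simp add: theta3_eq theta4_eq power2_eq_square theta_half_alternating)

lemma theta2_sq: "(theta2 x)\<^sup>2 = 2 * theta2 (2 * x) * theta3 (2 * x)"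
  using theta_mult[OF x, of 1 1 "1/2" "1/2"]
  by (simp add: theta3_eq theta2_eq power2_eq_square theta_one_shift)

end

text \<open>
  Jacobi's identity, by factoring a difference of squares and applying duplication to each
  factor.
\<close>

lemma theta_quartic:
  assumes "x > 0"
  shows "theta3 x ^ 4 = theta2 x ^ 4 + theta4 x ^ 4"
proof -
  have "theta3 x ^ 4 - theta2 x ^ 4 = ((theta3 x)\<^sup>2 + (theta2 x)\<^sup>2) * ((theta3 x)\<^sup>2 - (theta2 x)\<^sup>2)"
    by algebra
  also have "\<dots> = (theta3 (x / 2) * theta4 (x / 2))\<^sup>2"
    using theta3_sq[of "x / 2"] theta4_sq[of "x / 2"] assms by (simp add: power_mult_distrib)
  also have "\<dots> = theta4 x ^ 4"
    using theta3_theta4[of "x / 2"] assms by (simp flip: power_mult)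
  finally show ?thesis by simp
qed

section \<open>Limits at infinity and at zero\<close>

text \<open>
  Controls the tails of all theta series for large \<open>x\<close>: the part of the exponent beyond \<open>x = 1\<close>
  is bounded by its slowest term, and the value at \<open>1\<close> absorbs the rest.
\<close>

lemma gaussian_sum_exp_decay:
  fixes A :: "int set"
  assumes "x \<ge> 1" and m: "\<And>k. k \<in> A \<Longrightarrow> m \<le> (of_int k + a)\<^sup>2"
  shows "(\<Sum>\<^sub>\<infinity>k\<in>A. exp (- pi * (of_int k + a)\<^sup>2 * x)) \<le> exp (- pi * m * (x - 1)) * theta a 1 1"
proof -
  let ?e = "\<lambda>x k. exp (- pi * (of_int k + a)\<^sup>2 * x)"
  have s: "?e y summable_on A" if "y > 0" for y
    using gaussian_summable_on_int[OF that] by (rule summable_on_subset_banach) auto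
  have "infsum (?e x) A \<le> (\<Sum>\<^sub>\<infinity>k\<in>A. exp (- pi * m * (x - 1)) * ?e 1 k)"
  proof (rule infsum_mono)
    fix k assume k: "k \<in> A"
    have "pi * m * (x - 1) \<le> pi * (of_int k + a)\<^sup>2 * (x - 1)"
      using m[OF k] assms(1) by (intro mult_right_mono mult_left_mono) auto
    then show "?e x k \<le> exp (- pi * m * (x - 1)) * ?e 1 k"
      unfolding exp_add[symmetric] by (simp add: algebra_simps)
  qed (use assms(1) in \<open>intro s summable_on_cmult_right; simp\<close>)+
  also have "\<dots> = exp (- pi * m * (x - 1)) * infsum (?e 1) A"
    by (rule infsum_cmult_right')
  also have "\<dots> \<le> exp (- pi * m * (x - 1)) * infsum (?e 1) UNIV"
    by (intro mult_left_mono infsum_mono2 s gaussian_summable_on_int) auto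
  finally show ?thesis by (simp add: theta_def)
qed

lemma theta_0_sub_1_bound:
  assumes "x \<ge> 1" "\<bar>s\<bar> = 1"
  shows "\<bar>theta 0 s x - 1\<bar> \<le> exp (- pi * (x - 1)) * theta3 1"
proof -
  let ?e = "\<lambda>k. s powi k * exp (- pi * (of_int k + 0)\<^sup>2 * x)"
  have x0: "x > 0" using assms by simp
  have "infsum ?e (UNIV - {0}) = infsum ?e UNIV - infsum ?e {0}"
    by (intro infsum_Diff theta_summable x0 assms(2)) auto
  then have "theta 0 s x - 1 = infsum ?e (UNIV - {0})"
    by (simp add: theta_def)
  also have "\<bar>\<dots>\<bar> \<le> (\<Sum>\<^sub>\<infinity>k\<in>UNIV - {0}. norm (?e k))"
    unfolding real_norm_def[symmetric] by (rule norm_infsum_bound)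
      (rule summable_on_subset_banach[OF theta_abs_summable[OF x0 assms(2)]], simp)
  also have "\<dots> = (\<Sum>\<^sub>\<infinity>k\<in>UNIV - {0}. exp (- pi * (of_int k + 0)\<^sup>2 * x))"
    by (intro infsum_cong) (simp add: abs_mult abs_powi_1[OF assms(2)])
  also have "\<dots> \<le> exp (- pi * 1 * (x - 1)) * theta 0 1 1"
  proof (rule gaussian_sum_exp_decay[OF assms(1)])
    fix k :: int assume "k \<in> UNIV - {0}"
    then have "1 \<le> k\<^sup>2" by (simp add: int_one_le_iff_zero_less)
    then have "(1::real) \<le> of_int (k\<^sup>2)" unfolding of_int_1_le_iff .
    then show "1 \<le> (real_of_int k + 0)\<^sup>2" by simp
  qed
  finally show ?thesis by (simp add: theta3_eq)
qed

lemma theta_0_tendsto_1: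
  assumes "\<bar>s\<bar> = 1"
  shows "(theta 0 s \<longlongrightarrow> 1) at_top"
proof -
  have "theta3 1 \<ge> 0"
    by (simp add: theta3_def infsum_nonneg)
  have "norm (theta 0 s x - 1) \<le> inverse x * theta3 1" if "x \<ge> 1" for x
  proof -
    have "x - 1 \<le> pi * (x - 1)" 
      using that pi_ge_two by (intro mult_right_mono[of 1 pi "x - 1", simplified]) auto
    then have "x \<le> exp (pi * (x - 1))"
      using exp_ge_add_one_self[of "pi * (x - 1)"] by linarith
    then have "exp (- pi * (x - 1)) \<le> inverse x"
      using that by (simp add: exp_minus)
    then have "exp (- pi * (x - 1)) * theta3 1 \<le> inverse x * theta3 1"
      using \<open>theta3 1 \<ge> 0\<close> by (rule mult_right_mono)
    with theta_0_sub_1_bound[OF that assms] show ?thesis by simp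
  qed
  then have "\<forall>\<^sub>F x in at_top. norm (theta 0 s x - 1) \<le> inverse x * theta3 1"
    using eventually_ge_at_top[of 1] by (rule eventually_mono[rotated])
  moreover have "((\<lambda>x. inverse x * theta3 1) \<longlongrightarrow> 0) at_top"
    by (intro tendsto_mult_left_zero tendsto_inverse_0_at_top filterlim_ident)
  ultimately have "((\<lambda>x. theta 0 s x - 1) \<longlongrightarrow> 0) at_top"
    by (rule Lim_null_comparison)
  then show ?thesis by (simp add: LIM_zero_iff)
qed

lemma theta3_ge_1: "x > 0 \<Longrightarrow> theta3 x \<ge> 1"
  using finite_sum_le_infsum[OF gaussian_summable_on_int[of x 0], of "{0}"]
  by (simp add: theta3_def)

lemma theta3_pos: "x > 0 \<Longrightarrow> theta3 x > 0"
  using theta3_ge_1[of x] by simp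

lemma theta2_ge: "x > 0 \<Longrightarrow> theta2 x \<ge> exp (- pi * x / 4)"
  using finite_sum_le_infsum[OF gaussian_summable_on_int[of x "1/2"], of "{0}"]
  by (simp add: theta2_def power2_eq_square)

lemma theta2_pos: "x > 0 \<Longrightarrow> theta2 x > 0"
  using theta2_ge[of x] exp_gt_zero[of "- pi * x / 4"] by linarith

lemma filterlim_doubling:
  fixes x :: real
  assumes "x > 0"
  shows "filterlim (\<lambda>n. 2 ^ n * x) at_top sequentially"
proof (rule filterlim_at_top_mono)
  show "filterlim (\<lambda>n. x * real n) at_top sequentially"
    by (rule filterlim_tendsto_pos_mult_at_top[OF tendsto_const assms filterlim_real_sequentially])
  have "x * real n \<le> 2 ^ n * x" for n
    using assms of_nat_less_two_power[of n, where 'a = real] by (simp add: mult.commute)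
  then show "\<forall>\<^sub>F n in sequentially. x * real n \<le> 2 ^ n * x"
    by simp
qed

text \<open>
  The alternating series hides its sign. By \<open>\<theta>\<^sub>3 \<theta>\<^sub>4 = \<theta>\<^sub>4(2\<cdot>)\<^sup>2\<close> it is nonnegative, and a zero
  at \<open>x\<close> would propagate to all \<open>2\<^sup>n x\<close>, against the limit \<open>1\<close> at infinity.
\<close>

lemma theta4_pos:
  assumes "x > 0"
  shows "theta4 x > 0"
proof -
  have nonneg: "theta4 y \<ge> 0" if "y > 0" for y
    using theta3_theta4[OF that] theta3_pos[OF that]
    by (metis less_eq_real_def not_less zero_le_power2 mult_less_0_iff mult_pos_neg order_less_irrefl)
  have "theta4 x \<noteq> 0"
  proof
    assume 0: "theta4 x = 0"
    have "theta4 (2 ^ n * x) = 0" for n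
    proof (induction n)
      case (Suc n)
      then show ?case
        using theta3_theta4[of "2 ^ n * x"] assms by (simp add: mult.assoc)
    qed (use 0 in simp)
    moreover have "(\<lambda>n. theta4 (2 ^ n * x)) \<longlonglongrightarrow> 1"
      unfolding theta4_eq
      by (rule filterlim_compose[OF theta_0_tendsto_1 filterlim_doubling[OF assms]]) simp
    ultimately show False
      using LIMSEQ_unique[of "\<lambda>n. 0::real" 0 1] by simp
  qed
  with nonneg[OF assms] show ?thesis by simp
qed

lemma gaussian_integral_scaled:
  assumes "x > 0"
  shows "has_bochner_integral lborel (\<lambda>t. indicator {0..} t *\<^sub>R exp (- pi * t\<^sup>2 * x)) (1 / (2 * sqrt x))"
proof -
  define c where "c = sqrt (pi * x)"
  have c: "c > 0" "c\<^sup>2 = pi * x" using assms by (auto simp: c_def)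
  have "has_bochner_integral lborel (\<lambda>t. indicator {0..} (0 + c * t) *\<^sub>R exp (- (0 + c * t)\<^sup>2)) ((sqrt pi / 2) /\<^sub>R \<bar>c\<bar>)"
    using c(1) gaussian_moment_0
    by (subst lborel_has_bochner_integral_real_affine_iff[symmetric]) auto
  moreover have "(\<lambda>t. indicator {0..} (0 + c * t) *\<^sub>R exp (- (0 + c * t)\<^sup>2))
      = (\<lambda>t. indicator {0..} t *\<^sub>R exp (- pi * t\<^sup>2 * x))"
    using c by (auto simp: fun_eq_iff indicator_def power_mult_distrib zero_le_mult_iff mult_ac)
  moreover have "(sqrt pi / 2) /\<^sub>R \<bar>c\<bar> = 1 / (2 * sqrt x)"
    using c assms by (simp add: c_def real_sqrt_mult field_simps)
  ultimately show ?thesis by metis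
qed

text \<open>
  Comparing the decreasing function \<open>exp (- \<pi> t\<^sup>2 x)\<close> with its integral over the half line costs
  at most its value at \<open>0\<close>. Rescaled, this is the Riemann sum limit of \<open>\<surd>x \<theta>\<^sub>3 x\<close>, with a rate.
\<close>

lemma theta3_near_0:
  assumes "x > 0"
  shows "\<bar>sqrt x * theta3 x - 1\<bar> \<le> sqrt x"
proof -
  define f where "f = (\<lambda>t. exp (- pi * t\<^sup>2 * x))"
  interpret antimono_fun_sum_integral_diff f
  proof
    show "f t \<ge> f u" if "t \<ge> 0" "t \<le> u" for t u
      using that assms by (auto simp: f_def intro!: mult_right_mono mult_left_mono power_mono)
    show "continuous_on {0..} f"
      unfolding f_def by (intro continuous_intros)
  qed (simp add: f_def)
  have Z: "(\<lambda>k::int. f (of_int k)) summable_on UNIV" "infsum (\<lambda>k::int. f (of_int k)) UNIV = theta3 x"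
    using gaussian_summable_on_int[OF assms, of 0] by (simp_all add: f_def theta3_def)
  have Zsub: "(\<lambda>k::int. f (of_int k)) summable_on A" for A
    using Z(1) by (rule summable_on_subset_banach) simp
  have N: "(\<lambda>n. f (real n)) summable_on UNIV"
    using Zsub[of "range int"] by (subst (asm) summable_on_reindex) (auto simp: o_def)
  \<comment> \<open>Over the integers the value at zero is counted once, hence \<open>theta3 x = 2 * s - 1\<close>.\<close>
  define s where "s = infsum (\<lambda>n. f (real n)) UNIV"
  have sums: "(\<lambda>n. f (real n)) sums s"
    using has_sum_imp_sums[OF has_sum_infsum[OF N]] by (simp add: s_def)
  have N': "(\<lambda>n. f (real (Suc n))) summable_on UNIV"
    using sums summable_Suc_iff[of "\<lambda>n. f (real n)"]
    by (intro summable_nonneg_imp_summable_on) (auto simp: sums_iff f_def)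
  have "theta3 x = infsum (\<lambda>k. f (of_int k)) (range int \<union> range (\<lambda>n. - 1 - int n))"
    by (simp only: UNIV_int_split[symmetric] Z(2))
  also have "\<dots> = infsum (\<lambda>k. f (of_int k)) (range int) + infsum (\<lambda>k. f (of_int k)) (range (\<lambda>n. - 1 - int n))"
    by (rule infsum_Un_disjoint[OF Zsub Zsub]) auto
  also have "infsum (\<lambda>k. f (of_int k)) (range int) = s"
    by (subst infsum_reindex) (auto simp: s_def o_def)
  also have "infsum (\<lambda>k. f (of_int k)) (range (\<lambda>n. - 1 - int n)) = infsum (\<lambda>n. f (real (Suc n))) UNIV"
    by (subst infsum_reindex)
      (auto simp: inj_def f_def power2_eq_square algebra_simps intro!: infsum_cong)
  also have "\<dots> = s - f 0"
  proof (rule sums_unique2)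
    show "(\<lambda>n. f (real (Suc n))) sums (s - f 0)"
      using sums sums_Suc_iff[of "\<lambda>n. f (real n)" "s - f 0"] by simp
  qed (rule has_sum_imp_sums[OF has_sum_infsum[OF N']])
  finally have th: "theta3 x = 2 * s - 1" by (simp add: f_def)
  have lim_int: "(\<lambda>n. integral {0..real n} f) \<longlonglongrightarrow> 1 / (2 * sqrt x)"
  proof -
    note G = gaussian_integral_scaled[OF assms]
    have int: "set_integrable lborel {0..} f"
      using G by (auto simp: set_integrable_def f_def has_bochner_integral_iff)
    have val: "set_lebesgue_integral lborel {0..} f = 1 / (2 * sqrt x)"
      using G by (simp add: set_lebesgue_integral_def f_def has_bochner_integral_iff)
    have "((\<lambda>b. set_lebesgue_integral lborel {0..b} f) \<longlongrightarrow> 1 / (2 * sqrt x)) at_top"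
      using tendsto_set_lebesgue_integral_at_top[OF _ int] val by simp
    then have "(\<lambda>n. set_lebesgue_integral lborel {0..real n} f) \<longlonglongrightarrow> 1 / (2 * sqrt x)"
      by (rule filterlim_compose[OF _ filterlim_real_sequentially])
    moreover have "set_lebesgue_integral lborel {0..real n} f = integral {0..real n} f" for n
      by (rule set_borel_integral_eq_integral(2)) (rule set_integrable_subset[OF int], auto)
    ultimately show ?thesis by simp
  qed
  have "sum_integral_diff_series \<longlonglongrightarrow> s - 1 / (2 * sqrt x)"
    unfolding sum_integral_diff_series_def
    using sums lim_int by (intro tendsto_diff) (auto simp: sums_def_le)
  note lim = this
  have lo: "0 \<le> s - 1 / (2 * sqrt x)"
    using sum_integral_diff_series_nonneg by (intro LIMSEQ_le_const[OF lim]) simp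
  have "s - 1 / (2 * sqrt x) \<le> sum_integral_diff_series 0"
    using sum_integral_diff_series_antimono[of 0] by (intro LIMSEQ_le_const2[OF lim]) simp
  then have hi: "s - 1 / (2 * sqrt x) \<le> 1"
    unfolding sum_integral_diff_series_def by (simp add: f_def)
  have "sqrt x * theta3 x - 1 = sqrt x * (2 * (s - 1 / (2 * sqrt x)) - 1)"
    using assms by (simp add: th field_simps)
  also have "\<bar>\<dots>\<bar> \<le> sqrt x * 1"
    using assms lo hi by (simp only: abs_mult) (intro mult_mono, auto)
  finally show ?thesis by simp
qed

section \<open>The functional equation by the arithmetic-geometric mean\<close>

definition ratio43 :: "real \<Rightarrow> real" where
  "ratio43 x = theta4 x / theta3 x"

definition ratio23 :: "real \<Rightarrow> real" where
  "ratio23 x = theta2 x / theta3 x"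

lemma ratio_quartic:
  assumes "x > 0"
  shows "ratio23 x ^ 4 + ratio43 x ^ 4 = 1"
proof -
  have "theta2 x ^ 4 + theta4 x ^ 4 \<noteq> 0"
    using theta2_pos[OF assms] theta4_pos[OF assms] by (smt (verit) zero_less_power)
  then show ?thesis
    by (simp add: ratio23_def ratio43_def power_divide theta_quartic[OF assms] flip: add_divide_distrib)
qed

lemma ratio_pos:
  assumes "x > 0"
  shows "ratio43 x > 0" "ratio23 x > 0"
  using assms by (simp_all add: ratio43_def ratio23_def theta2_pos theta3_pos theta4_pos)

lemma ratio_less_1:
  assumes "x > 0"
  shows "ratio43 x < 1" "ratio23 x < 1"
proof -
  have "ratio43 x ^ 4 < 1 ^ 4" "ratio23 x ^ 4 < 1 ^ 4"
    using ratio_quartic[OF assms] zero_less_power[OF ratio_pos(1)[OF assms], of 4]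
      zero_less_power[OF ratio_pos(2)[OF assms], of 4] unfolding power_one by linarith+
  from this[THEN power_less_imp_less_base] show "ratio43 x < 1" "ratio23 x < 1"
    by simp_all
qed

lemma theta3_double_sq:
  assumes "x > 0"
  shows "(theta3 (2 * x))\<^sup>2 = (theta3 x)\<^sup>2 * (1 + (ratio43 x)\<^sup>2) / 2"
proof -
  have "(theta3 x)\<^sup>2 * (1 + (ratio43 x)\<^sup>2) = (theta3 x)\<^sup>2 + (theta4 x)\<^sup>2"
    using theta3_pos[OF assms] by (simp add: ratio43_def power_divide distrib_left)
  then show ?thesis
    using theta3_sq[OF assms] theta4_sq[OF assms] by simp
qed

lemma theta3_half_sq:
  assumes "x > 0"
  shows "(theta3 (x / 2))\<^sup>2 = (theta3 x)\<^sup>2 * (1 + (ratio23 x)\<^sup>2)"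
  using theta3_sq[of "x / 2"] theta3_pos[OF assms] assms
  by (simp add: ratio23_def field_simps)

text \<open>
  In terms of \<open>ratio43\<close> this is one step of the arithmetic-geometric mean. The next lemma is the
  same recursion run towards zero for \<open>ratio23\<close>; that the two agree is the source of the
  functional equation.
\<close>

lemma ratio43_double:
  assumes "x > 0"
  shows "(ratio43 (2 * x))\<^sup>2 = 2 * ratio43 x / (1 + (ratio43 x)\<^sup>2)"
proof -
  have "(theta4 (2 * x))\<^sup>2 = (theta3 x)\<^sup>2 * ratio43 x"
    using theta3_theta4[OF assms] theta3_pos[OF assms]
    by (simp add: ratio43_def power2_eq_square)
  then show ?thesis
    using theta3_pos[OF assms]
    unfolding ratio43_def[of "2 * x"] power_divide theta3_double_sq[OF assms] by simp
qed

lemma ratio23_half: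
  assumes "x > 0"
  shows "(ratio23 (x / 2))\<^sup>2 = 2 * ratio23 x / (1 + (ratio23 x)\<^sup>2)"
proof -
  have "(theta2 (x / 2))\<^sup>2 = (theta3 x)\<^sup>2 * (2 * ratio23 x)"
    using theta2_sq[of "x / 2"] theta3_pos[OF assms] assms
    by (simp add: ratio23_def power2_eq_square)
  then show ?thesis
    using theta3_half_sq[OF assms] theta3_pos[OF assms]
    unfolding ratio23_def[of "x / 2"] by (simp add: power_divide)
qed

text \<open>
  The transformation law of \<open>\<theta>\<^sub>3\<close> says that this quotient is constantly one.
\<close>

definition theta3_defect :: "real \<Rightarrow> real" where
  "theta3_defect x = (theta3 (1 / x))\<^sup>2 / (x * (theta3 x)\<^sup>2)"

lemma theta3_defect_pos: "x > 0 \<Longrightarrow> theta3_defect x > 0"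
  using theta3_pos[of x] theta3_pos[of "1 / x"] by (simp add: theta3_defect_def)

lemma theta3_defect_inverse: "x > 0 \<Longrightarrow> theta3_defect (1 / x) = 1 / theta3_defect x"
  by (simp add: theta3_defect_def)

text \<open>
  The defect grows under doubling exactly when \<open>ratio43 x\<close> lies below \<open>ratio23 (1/x)\<close>.
\<close>

lemma theta3_defect_double:
  assumes "x > 0"
  shows "theta3_defect (2 * x) = theta3_defect x * ((1 + (ratio23 (1 / x))\<^sup>2) / (1 + (ratio43 x)\<^sup>2))"
proof -
  have "(theta3 (1 / (2 * x)))\<^sup>2 = (theta3 (1 / x))\<^sup>2 * (1 + (ratio23 (1 / x))\<^sup>2)"
    using theta3_half_sq[of "1 / x"] assms by (simp add: mult.commute)
  then show ?thesis
    by (simp add: theta3_defect_def theta3_double_sq[OF assms])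
qed

lemma theta3_defect_tendsto_1:
  assumes "x > 0"
  shows "(\<lambda>n. theta3_defect (2 ^ n * x)) \<longlonglongrightarrow> 1"
proof -
  let ?X = "\<lambda>n. 2 ^ n * x"
  have X: "filterlim ?X at_top sequentially" by (rule filterlim_doubling[OF assms])
  have lim3: "(\<lambda>n. theta3 (?X n)) \<longlonglongrightarrow> 1"
    unfolding theta3_eq by (rule filterlim_compose[OF theta_0_tendsto_1 X]) simp
  have inv: "(\<lambda>n. sqrt (1 / ?X n)) \<longlonglongrightarrow> sqrt 0"
    using tendsto_inverse_0_at_top[OF X] by (intro tendsto_real_sqrt) (simp add: inverse_eq_divide)
  have "(\<lambda>n. sqrt (1 / ?X n) * theta3 (1 / ?X n) - 1) \<longlonglongrightarrow> 0"
    by (rule Lim_null_comparison[OF always_eventually inv[simplified real_sqrt_zero]])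
      (use theta3_near_0 assms in auto)
  then have "(\<lambda>n. sqrt (1 / ?X n) * theta3 (1 / ?X n)) \<longlonglongrightarrow> 1"
    by (simp add: LIM_zero_iff)
  from tendsto_divide[OF tendsto_power[OF this, of 2] tendsto_power[OF lim3, of 2]]
  have "(\<lambda>n. (sqrt (1 / ?X n) * theta3 (1 / ?X n))\<^sup>2 / (theta3 (?X n))\<^sup>2) \<longlonglongrightarrow> 1"
    by simp
  moreover have "(sqrt (1 / ?X n) * theta3 (1 / ?X n))\<^sup>2 / (theta3 (?X n))\<^sup>2 = theta3_defect (?X n)" for n
    using assms by (simp add: theta3_defect_def power_mult_distrib)
  ultimately show ?thesis by simp
qed

text \<open>
  Both sides evolve by \<open>a \<mapsto> \<surd>(2 a / (1 + a\<^sup>2))\<close>, which is strictly increasing on \<open>(0, 1)\<close>.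
\<close>

lemma ratio_comparison_double:
  assumes "x > 0"
  shows "ratio43 (2 * x) \<le> ratio23 (1 / (2 * x)) \<longleftrightarrow> ratio43 x \<le> ratio23 (1 / x)"
proof -
  define a b where "a = ratio43 x" and "b = ratio23 (1 / x)"
  have ab: "0 < a" "a < 1" "0 < b" "b < 1"
    using assms by (auto simp: a_def b_def ratio_pos ratio_less_1)
  have "ratio43 (2 * x) \<le> ratio23 (1 / (2 * x)) \<longleftrightarrow> (ratio43 (2 * x))\<^sup>2 \<le> (ratio23 (1 / (2 * x)))\<^sup>2"
    using ratio_pos[of "2 * x"] ratio_pos[of "1 / (2 * x)"] assms by (subst power_mono_iff) auto
  also have "\<dots> \<longleftrightarrow> 2 * a / (1 + a\<^sup>2) \<le> 2 * b / (1 + b\<^sup>2)"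
    using ratio43_double[OF assms] ratio23_half[of "1 / x"] assms
    by (simp add: a_def b_def mult.commute)
  also have "\<dots> \<longleftrightarrow> a * (1 + b\<^sup>2) \<le> b * (1 + a\<^sup>2)"
  proof -
    have "0 < 1 + a\<^sup>2" "0 < 1 + b\<^sup>2" by (simp_all add: add_pos_nonneg)
    then have "2 * a / (1 + a\<^sup>2) \<le> 2 * b / (1 + b\<^sup>2) \<longleftrightarrow> 2 * (a * (1 + b\<^sup>2)) \<le> 2 * (b * (1 + a\<^sup>2))"
      by (simp add: pos_divide_le_eq pos_le_divide_eq mult_ac)
    then show ?thesis by simp
  qed
  also have "\<dots> \<longleftrightarrow> 0 \<le> (b - a) * (1 - a * b)"
    by (simp add: algebra_simps power2_eq_square)
  also have "\<dots> \<longleftrightarrow> a \<le> b"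
  proof -
    have "a * b < 1 * 1" using ab by (intro mult_strict_mono) auto
    then show ?thesis by (simp add: zero_le_mult_iff)
  qed
  finally show ?thesis by (simp add: a_def b_def)
qed

lemma ratio_comparison_doubling:
  assumes "x > 0"
  shows "ratio43 (2 ^ n * x) \<le> ratio23 (1 / (2 ^ n * x)) \<longleftrightarrow> ratio43 x \<le> ratio23 (1 / x)"
proof (induction n)
  case (Suc n)
  then show ?case using ratio_comparison_double[of "2 ^ n * x"] assms by (simp add: mult.assoc)
qed simp

text \<open>
  The defect increases strictly at the first doubling and weakly ever after, towards its limit
  one.
\<close>

lemma theta3_defect_less_1:
  assumes "x > 0" "ratio43 x < ratio23 (1 / x)"
  shows "theta3_defect x < 1"
proof -
  have step: "theta3_defect y \<le> theta3_defect (2 * y)"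
    "ratio43 y < ratio23 (1 / y) \<Longrightarrow> theta3_defect y < theta3_defect (2 * y)"
    if "y > 0" "ratio43 y \<le> ratio23 (1 / y)" for y
  proof -
    have k: "0 < 1 + (ratio43 y)\<^sup>2" by (simp add: add_pos_nonneg)
    note r = ratio_pos(1)[OF that(1)] and d = theta3_defect_pos[OF that(1)]
    have "theta3_defect y * 1 \<le> theta3_defect (2 * y)"
      unfolding theta3_defect_double[OF that(1)]
      using k r d that(2) by (intro mult_left_mono) (auto simp: le_divide_eq_1 power_mono)
    then show "theta3_defect y \<le> theta3_defect (2 * y)" by simp
    assume "ratio43 y < ratio23 (1 / y)"
    then have "theta3_defect y * 1 < theta3_defect (2 * y)"
      unfolding theta3_defect_double[OF that(1)]
      using k r d by (intro mult_strict_left_mono) (auto simp: less_divide_eq_1 power_strict_mono)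
    then show "theta3_defect y < theta3_defect (2 * y)" by simp
  qed
  have "incseq (\<lambda>n. theta3_defect (2 ^ n * (2 * x)))"
  proof (rule incseq_SucI)
    fix n
    show "theta3_defect (2 ^ n * (2 * x)) \<le> theta3_defect (2 ^ Suc n * (2 * x))"
      using step(1)[of "2 ^ Suc n * x"] ratio_comparison_doubling[OF assms(1), of "Suc n"] assms
      by (simp add: mult_ac)
  qed
  from incseq_le[OF this theta3_defect_tendsto_1, of 0] assms
  have "theta3_defect (2 * x) \<le> 1" by simp
  with step(2)[of x] assms show ?thesis by simp
qed

lemma theta3_defect_greater_1:
  assumes "x > 0" "ratio23 (1 / x) < ratio43 x"
  shows "theta3_defect x > 1"
proof -
  have step: "theta3_defect (2 * y) < theta3_defect y" if "y > 0" "ratio23 (1 / y) < ratio43 y" for y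
  proof -
    have k: "0 < 1 + (ratio43 y)\<^sup>2" by (simp add: add_pos_nonneg)
    have "0 < ratio23 (1 / y)" using that ratio_pos(2)[of "1 / y"] by simp
    then have "theta3_defect (2 * y) < theta3_defect y * 1"
      unfolding theta3_defect_double[OF that(1)]
      using k theta3_defect_pos[OF that(1)] that(2)
      by (intro mult_strict_left_mono) (auto simp: divide_less_eq_1 power_strict_mono)
    then show ?thesis by simp
  qed
  have "decseq (\<lambda>n. theta3_defect (2 ^ n * (2 * x)))"
  proof (rule decseq_SucI)
    fix n
    show "theta3_defect (2 ^ Suc n * (2 * x)) \<le> theta3_defect (2 ^ n * (2 * x))"
      using step[of "2 ^ Suc n * x"] ratio_comparison_doubling[OF assms(1), of "Suc n"] assms
      by (simp add: mult_ac not_le less_imp_le)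
  qed
  from decseq_ge[OF this theta3_defect_tendsto_1, of 0] assms
  have "1 \<le> theta3_defect (2 * x)" by simp
  with step[of x] assms show ?thesis by simp
qed

text \<open>
  If the two ratios differ at \<open>x\<close>, the quartic identity makes them differ in the same direction
  at \<open>1/x\<close>. Then the defects at \<open>x\<close> and \<open>1/x\<close> lie strictly on the same side of one, but they are
  inverse to each other.
\<close>

lemma ratio_modular:
  assumes "x > 0"
  shows "ratio43 x = ratio23 (1 / x)"
proof (rule linorder_cases[of "ratio43 x" "ratio23 (1 / x)"])
  have pos: "1 / x > 0" using assms by simp
  note nonneg = ratio_pos[OF assms, THEN less_imp_le] ratio_pos[OF pos, THEN less_imp_le]
  have quartic: "ratio43 (1 / x) ^ 4 - ratio23 x ^ 4 = ratio43 x ^ 4 - ratio23 (1 / x) ^ 4"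
    using ratio_quartic[OF assms] ratio_quartic[OF pos] by simp
  {
    assume less: "ratio43 x < ratio23 (1 / x)"
    then have "ratio43 x ^ 4 < ratio23 (1 / x) ^ 4"
      using nonneg by (intro power_strict_mono) auto
    then have "ratio43 (1 / x) ^ 4 < ratio23 x ^ 4" using quartic by simp
    then have "ratio43 (1 / x) < ratio23 (1 / (1 / x))"
      using nonneg by (simp add: power_less_imp_less_base)
    from theta3_defect_less_1[OF pos this] theta3_defect_less_1[OF assms less]
    show ?thesis
      using theta3_defect_inverse[OF assms] theta3_defect_pos[OF assms] by simp
  next
    assume less: "ratio23 (1 / x) < ratio43 x"
    then have "ratio23 (1 / x) ^ 4 < ratio43 x ^ 4"
      using nonneg by (intro power_strict_mono) auto
    then have "ratio23 x ^ 4 < ratio43 (1 / x) ^ 4" using quartic by simp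
    then have "ratio23 (1 / (1 / x)) < ratio43 (1 / x)"
      using nonneg by (simp add: power_less_imp_less_base)
    from theta3_defect_greater_1[OF pos this] theta3_defect_greater_1[OF assms less]
    show ?thesis
      using theta3_defect_inverse[OF assms] theta3_defect_pos[OF assms] by simp
  }
qed

text \<open>
  With equal ratios the defect is unchanged by doubling, so it equals its limit.
\<close>

lemma theta3_modular:
  assumes "x > 0"
  shows "theta3 (1 / x) = sqrt x * theta3 x"
proof -
  have const: "theta3_defect (2 ^ n * x) = theta3_defect x" for n
  proof (induction n)
    case (Suc n)
    have "2 ^ n * x > 0" using assms by simp
    with Suc show ?case
      using theta3_defect_double[of "2 ^ n * x"] ratio_modular[of "2 ^ n * x"]
      by (simp add: mult.assoc add_pos_nonneg less_imp_neq[symmetric])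
  qed simp
  have "theta3_defect x = 1"
    using theta3_defect_tendsto_1[OF assms] LIMSEQ_unique[OF tendsto_const]
    unfolding const by blast
  then have "(theta3 (1 / x))\<^sup>2 = (sqrt x * theta3 x)\<^sup>2"
    using assms theta3_pos[OF assms]
    by (simp add: theta3_defect_def power_mult_distrib)
  then show ?thesis
    using assms theta3_pos[OF assms] theta3_pos[of "1 / x"] by (simp add: power2_eq_iff_nonneg)
qed

lemma theta2_modular:
  assumes "x > 0"
  shows "theta2 (1 / x) = sqrt x * theta4 x"
  using ratio_modular[OF assms] theta3_modular[OF assms] theta3_pos[OF assms] theta3_pos[of "1 / x"] assms
  by (simp add: ratio43_def ratio23_def field_simps)

section \<open>Strict convexity\<close>

text \<open>
  Equivalent to the usual notion with strict inequality for all weights, but strictness has to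
  be carried only for midpoints, where a product formula for \<open>cosh\<close> settles it.
\<close>

definition strictly_convex :: "(real \<Rightarrow> real) \<Rightarrow> bool" where
  "strictly_convex G \<longleftrightarrow> convex_on UNIV G \<and> (\<forall>u v. u \<noteq> v \<longrightarrow> G ((u + v) / 2) < (G u + G v) / 2)"

lemma convex_on_UNIV_iff:
  fixes G :: "real \<Rightarrow> real"
  shows "convex_on UNIV G \<longleftrightarrow>
    (\<forall>l u v. 0 \<le> l \<longrightarrow> l \<le> 1 \<longrightarrow> G ((1 - l) * u + l * v) \<le> (1 - l) * G u + l * G v)"
  by (auto intro!: convex_onI dest: convex_onD)

lemma convex_onD_real:
  fixes G :: "real \<Rightarrow> real"
  assumes "convex_on UNIV G" "0 \<le> l" "l \<le> 1"
  shows "G ((1 - l) * u + l * v) \<le> (1 - l) * G u + l * G v"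
  using assms convex_on_UNIV_iff by blast

lemma convex_on_midpoint:
  fixes G :: "real \<Rightarrow> real"
  assumes "convex_on UNIV G"
  shows "G ((u + v) / 2) \<le> (G u + G v) / 2"
proof -
  have "(1 - 1/2) * x + 1/2 * y = (x + y) / 2" for x y :: real by (simp add: add_divide_distrib)
  with convex_onD_real[OF assms, of "1/2" u v] show ?thesis by (simp only:)
qed

lemma strictly_convex_affine:
  assumes G: "strictly_convex G" and "a > 0" "b \<noteq> 0"
  shows "strictly_convex (\<lambda>u. a * G (b * u + c) + (d * u + e))"
  unfolding strictly_convex_def convex_on_UNIV_iff
proof (intro conjI allI impI)
  fix l u v :: real assume l: "0 \<le> l" "l \<le> 1"
  have "G ((1 - l) * (b * u + c) + l * (b * v + c)) \<le> (1 - l) * G (b * u + c) + l * G (b * v + c)"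
    using G l by (intro convex_onD_real) (auto simp: strictly_convex_def)
  also have "(1 - l) * (b * u + c) + l * (b * v + c) = b * ((1 - l) * u + l * v) + c"
    by (simp add: algebra_simps)
  finally have "a * G (b * ((1 - l) * u + l * v) + c) \<le> a * ((1 - l) * G (b * u + c) + l * G (b * v + c))"
    using \<open>a > 0\<close> by (intro mult_left_mono) auto
  then show "a * G (b * ((1 - l) * u + l * v) + c) + (d * ((1 - l) * u + l * v) + e)
      \<le> (1 - l) * (a * G (b * u + c) + (d * u + e)) + l * (a * G (b * v + c) + (d * v + e))"
    by (simp add: algebra_simps)
next
  fix u v :: real assume "u \<noteq> v"
  then have "G (((b * u + c) + (b * v + c)) / 2) < (G (b * u + c) + G (b * v + c)) / 2"
    using G \<open>b \<noteq> 0\<close> unfolding strictly_convex_def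
    by (metis add_right_cancel mult_left_cancel)
  also have "((b * u + c) + (b * v + c)) / 2 = b * ((u + v) / 2) + c"
    by (simp add: algebra_simps add_divide_distrib)
  finally have "a * G (b * ((u + v) / 2) + c) < a * ((G (b * u + c) + G (b * v + c)) / 2)"
    using \<open>a > 0\<close> by (intro mult_strict_left_mono) auto
  then show "a * G (b * ((u + v) / 2) + c) + (d * ((u + v) / 2) + e)
      < (a * G (b * u + c) + (d * u + e) + (a * G (b * v + c) + (d * v + e))) / 2"
    by (simp add: algebra_simps add_divide_distrib)
qed

text \<open>
  \<open>G\<close> is the sum of the translates of \<open>g\<close> by multiples of \<open>t\<close>. The excess of \<open>G\<close> over a chord
  increases as the chord is translated and tends to zero, so it is nonpositive from the start;
  strictness comes from the first summand.
\<close>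

lemma strictly_convex_telescope:
  assumes g: "strictly_convex g" and G: "\<And>u. G u = G (u + t) + g u"
    and lim: "\<And>u. (\<lambda>n. G (u + real n * t)) \<longlonglongrightarrow> 0"
  shows "strictly_convex G"
proof -
  have cg: "convex_on UNIV g" using g by (simp add: strictly_convex_def)
  have conv: "convex_on UNIV G"
    unfolding convex_on_UNIV_iff
  proof (intro allI impI)
    fix l u v :: real assume l: "0 \<le> l" "l \<le> 1"
    define D where "D = (\<lambda>n. G ((1 - l) * u + l * v + real n * t)
      - ((1 - l) * G (u + real n * t) + l * G (v + real n * t)))"
    \<comment> \<open>One translation changes the excess of \<open>G\<close> by that of \<open>g\<close>, which is nonpositive.\<close>
    have "D n \<le> D (Suc n)" for n
    proof -
      have G': "G (w + real n * t) = G (w + real (Suc n) * t) + g (w + real n * t)" for w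
        using G[of "w + real n * t"] by (simp add: algebra_simps)
      have "g ((1 - l) * (u + real n * t) + l * (v + real n * t))
          \<le> (1 - l) * g (u + real n * t) + l * g (v + real n * t)"
        by (rule convex_onD_real[OF cg l])
      also have "(1 - l) * (u + real n * t) + l * (v + real n * t) = (1 - l) * u + l * v + real n * t"
        by (simp add: algebra_simps)
      finally show ?thesis
        unfolding D_def G' by (simp add: algebra_simps)
    qed
    then have "incseq D" by (rule incseq_SucI)
    moreover have "D \<longlonglongrightarrow> 0 - ((1 - l) * 0 + l * 0)"
      unfolding D_def by (intro tendsto_diff tendsto_add tendsto_mult tendsto_const lim)
    ultimately have "D 0 \<le> 0" using incseq_le[of D 0 0] by simp
    then show "G ((1 - l) * u + l * v) \<le> (1 - l) * G u + l * G v" by (simp add: D_def)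
  qed
  moreover have "G ((u + v) / 2) < (G u + G v) / 2" if "u \<noteq> v" for u v
  proof -
    define m where "m = (u + v) / 2"
    have "(u + t + (v + t)) / 2 = m + t" by (simp add: m_def field_simps)
    then have "G (m + t) \<le> (G (u + t) + G (v + t)) / 2"
      using convex_on_midpoint[OF conv, of "u + t" "v + t"] by metis
    moreover have "g m < (g u + g v) / 2"
      using g that by (simp add: strictly_convex_def m_def)
    ultimately show ?thesis
      using G[of u] G[of v] G[of m] unfolding m_def[symmetric] by argo
  qed
  ultimately show ?thesis by (simp add: strictly_convex_def)
qed

section \<open>Descent of convexity along the duplication map\<close>

text \<open>
  The map \<open>a \<mapsto> \<surd>(2 a / (1 + a\<^sup>2))\<close> by which the ratios evolve, in terms of \<open>y = - ln a\<close>: recall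
  \<open>2 a / (1 + a\<^sup>2) = 1 / cosh (ln a)\<close>.
\<close>

definition half_ln_cosh :: "real \<Rightarrow> real" where
  "half_ln_cosh y = ln (cosh y) / 2"

lemma half_ln_cosh_strict_mono: "0 \<le> a \<Longrightarrow> a < b \<Longrightarrow> half_ln_cosh a < half_ln_cosh b"
  by (simp add: half_ln_cosh_def cosh_real_nonneg_less_iff)

lemma half_ln_cosh_lipschitz:
  assumes "b \<le> a"
  shows "half_ln_cosh a \<le> half_ln_cosh b + (a - b) / 2"
proof -
  have "cosh a \<le> exp (a - b) * cosh b"
  proof -
    have "exp (- a) \<le> exp (a - b) * exp (- b)"
      using assms by (simp flip: exp_add)
    moreover have "exp a = exp (a - b) * exp b"
      by (simp flip: exp_add)
    ultimately show ?thesis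
      unfolding cosh_field_def by (simp add: distrib_left)
  qed
  then have "ln (cosh a) \<le> ln (exp (a - b) * cosh b)" by simp
  also have "\<dots> = (a - b) + ln (cosh b)" by (simp add: ln_mult)
  finally show ?thesis by (simp add: half_ln_cosh_def field_simps)
qed

text \<open>
  Midpoint strictness comes from \<open>cosh (m + d) cosh (m - d) = cosh\<^sup>2 m + sinh\<^sup>2 d\<close>.
\<close>

lemma half_ln_cosh_strictly_convex: "strictly_convex half_ln_cosh"
proof -
  have "convex_on UNIV half_ln_cosh"
  proof (rule convex_on_realI)
    show "(half_ln_cosh has_real_derivative tanh y / 2) (at y)" for y
      unfolding half_ln_cosh_def
      by (auto intro!: derivative_eq_intros simp: tanh_def less_imp_neq[symmetric])
  qed auto
  moreover have "half_ln_cosh ((a + b) / 2) < (half_ln_cosh a + half_ln_cosh b) / 2" if "a \<noteq> b" for a b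
  proof -
    let ?m = "(a + b) / 2" and ?d = "(a - b) / 2"
    have "a = ?m + ?d" "b = ?m - ?d" by (simp_all add: field_simps)
    then have "cosh a * cosh b = cosh (?m + ?d) * cosh (?m - ?d)" by simp
    also have "\<dots> = (cosh ?m)\<^sup>2 * (cosh ?d)\<^sup>2 - (sinh ?m)\<^sup>2 * (sinh ?d)\<^sup>2"
      unfolding cosh_add cosh_diff by (simp add: algebra_simps power2_eq_square)
    also have "\<dots> = (cosh ?m)\<^sup>2 + (sinh ?d)\<^sup>2"
      unfolding cosh_square_eq by (simp add: algebra_simps)
    finally have "(cosh ?m)\<^sup>2 < cosh a * cosh b" using that by simp
    then have "ln ((cosh ?m)\<^sup>2) < ln (cosh a * cosh b)" by simp
    then show ?thesis by (simp add: ln_mult ln_realpow half_ln_cosh_def field_simps)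
  qed
  ultimately show ?thesis by (simp add: strictly_convex_def)
qed

text \<open>
  The recursion lets convexity descend from the right, where \<open>h\<close> is close to \<open>k exp u\<close>: because
  \<open>half_ln_cosh\<close> is convex, contracts by a half and is increasing on the positive values of \<open>h\<close>,
  the excess over the chord halves with each step to the left, and it is bounded by \<open>2 C\<close> far to
  the right. Strictness needs \<open>h\<close> to be injective, which again is decided far to the right,
  where \<open>k exp u\<close> separates points by more than \<open>2 C\<close>.
\<close>

lemma strictly_convex_cosh_recurrence:
  fixes h :: "real \<Rightarrow> real"
  assumes pos: "\<And>u. h u > 0" and rec: "\<And>u. h u = half_ln_cosh (h (u + t))" and t: "t > 0"
    and "k > 0" and bound: "\<And>u. u \<ge> 0 \<Longrightarrow> \<bar>h u - k * exp u\<bar> \<le> C"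
  shows "strictly_convex h"
proof -
  have cF: "convex_on UNIV half_ln_cosh" using half_ln_cosh_strictly_convex by (simp add: strictly_convex_def)
  have mono: "half_ln_cosh a \<le> half_ln_cosh b" if "0 \<le> a" "a \<le> b" for a b
    using half_ln_cosh_strict_mono[of a b] that by (cases "a = b") auto
  have big: "filterlim (\<lambda>n. u + real n * t) at_top sequentially" for u
    by (intro filterlim_tendsto_add_at_top[OF tendsto_const]
        filterlim_at_top_mult_tendsto_pos[OF tendsto_const t filterlim_real_sequentially])
  have conv: "convex_on UNIV h"
    unfolding convex_on_UNIV_iff
  proof (intro allI impI)
    fix l u v :: real assume l: "0 \<le> l" "l \<le> 1"
    define w where "w = (1 - l) * u + l * v"
    define E where "E = (\<lambda>n. (1 - l) * h (u + real n * t) + l * h (v + real n * t))"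
    \<comment> \<open>\<open>D n\<close> is the failure of convexity after \<open>n\<close> shifts. Truncation at zero keeps the halving step
      valid also where the inequality already holds.\<close>
    define D where "D = (\<lambda>n. max 0 (h (w + real n * t) - E n))"
    have step: "D n \<le> D (Suc n) / 2" for n
    proof -
      have rec': "h (x + real n * t) = half_ln_cosh (h (x + real (Suc n) * t))" for x
        using rec[of "x + real n * t"] by (simp add: algebra_simps)
      have E0: "E (Suc n) \<ge> 0"
        unfolding E_def using l less_imp_le[OF pos] by (intro add_nonneg_nonneg mult_nonneg_nonneg) auto
      have "half_ln_cosh (E (Suc n)) \<le> E n"
        unfolding E_def rec' by (rule convex_onD_real[OF cF l])
      moreover have "h (w + real n * t) \<le> half_ln_cosh (E (Suc n)) + D (Suc n) / 2"
      proof (cases "E (Suc n) \<le> h (w + real (Suc n) * t)")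
        case True
        then show ?thesis
          using half_ln_cosh_lipschitz[OF True] unfolding rec' D_def by simp
      next
        case False
        then show ?thesis
          using mono[of "h (w + real (Suc n) * t)" "E (Suc n)"] pos[of "w + real (Suc n) * t"]
          unfolding rec' D_def by simp
      qed
      moreover have "0 \<le> D (Suc n)" by (simp add: D_def)
      moreover have "D n = max 0 (h (w + real n * t) - E n)" by (simp add: D_def)
      ultimately show ?thesis by linarith
    qed
    have D_le: "D 0 \<le> D n / 2 ^ n" for n
    proof (induction n)
      case (Suc n)
      have "D n / 2 ^ n \<le> (D (Suc n) / 2) / 2 ^ n"
        by (rule divide_right_mono[OF step]) simp
      with Suc show ?case by (simp add: mult.commute)
    qed simp
    have C0: "C \<ge> 0" using bound[of 0] by (rule order_trans[OF abs_ge_zero]) simp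
    have "\<forall>\<^sub>F n in sequentially. D n \<le> 2 * C"
      using filterlim_at_top[THEN iffD1, OF big[of u], rule_format, of 0]
        filterlim_at_top[THEN iffD1, OF big[of v], rule_format, of 0]
    proof eventually_elim
      case (elim n)
      define p q where "p = u + real n * t" and "q = v + real n * t"
      have w: "w + real n * t = (1 - l) * p + l * q"
        by (simp add: w_def p_def q_def algebra_simps)
      have "(1 - l) * p + l * q \<ge> 0" using elim l by (simp add: p_def q_def)
      then have "h (w + real n * t) \<le> k * exp ((1 - l) * p + l * q) + C"
        using bound[of "(1 - l) * p + l * q"] unfolding w by linarith
      also have "k * exp ((1 - l) * p + l * q) \<le> k * ((1 - l) * exp p + l * exp q)"
        using \<open>k > 0\<close> by (intro mult_left_mono convex_onD_real[OF exp_convex l]) auto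
      also have "k * ((1 - l) * exp p + l * exp q) = (1 - l) * (k * exp p) + l * (k * exp q)"
        by (simp add: algebra_simps)
      also have "\<dots> \<le> (1 - l) * (h p + C) + l * (h q + C)"
        using bound[of p] bound[of q] elim l
        by (intro add_mono mult_left_mono) (auto simp: p_def q_def abs_le_iff)
      also have "\<dots> = E n + C" by (simp add: E_def p_def q_def algebra_simps)
      finally show "D n \<le> 2 * C" using C0 by (simp add: D_def)
    qed
    then have "\<forall>\<^sub>F n in sequentially. D 0 \<le> 2 * C * (1/2) ^ n"
    proof eventually_elim
      case (elim n)
      then have "D n / 2 ^ n \<le> 2 * C / 2 ^ n" by (rule divide_right_mono) simp
      with D_le[of n] show ?case by (simp add: power_one_over)
    qed
    moreover have "(\<lambda>n. 2 * C * (1/2) ^ n) \<longlonglongrightarrow> 0"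
      by (intro tendsto_mult_right_zero LIMSEQ_power_zero) simp
    ultimately have "D 0 \<le> 0"
      by (intro tendsto_lowerbound[of _ 0 sequentially]) auto
    then show "h ((1 - l) * u + l * v) \<le> (1 - l) * h u + l * h v"
      by (simp add: D_def E_def w_def)
  qed
  \<comment> \<open>A coincidence of values would persist under all shifts to the right.\<close>
  have inj: "h u \<noteq> h v" if "u < v" for u v
  proof
    assume eq: "h u = h v"
    have "h (u + real n * t) = h (v + real n * t)" for n
    proof (induction n)
      case (Suc n)
      then have "half_ln_cosh (h (u + real (Suc n) * t)) = half_ln_cosh (h (v + real (Suc n) * t))"
        using rec[of "u + real n * t"] rec[of "v + real n * t"] by (simp add: algebra_simps)
      then show ?case
        using half_ln_cosh_strict_mono less_imp_le[OF pos]
        by (metis linorder_neqE_linordered_idom order_less_irrefl)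
    qed (simp add: eq)
    note eqn = this
    have "\<forall>\<^sub>F n in sequentially. exp (u + real n * t) \<le> 2 * C / (k * (exp (v - u) - 1))"
      using filterlim_at_top[THEN iffD1, OF big[of u], rule_format, of 0]
    proof eventually_elim
      case (elim n)
      have "k * exp (v + real n * t) - k * exp (u + real n * t) \<le> 2 * C"
        using bound[of "u + real n * t"] bound[of "v + real n * t"] elim that eqn[of n] by auto
      also have "exp (v + real n * t) = exp (u + real n * t) * exp (v - u)"
        by (simp flip: exp_add)
      finally show ?case
        using \<open>k > 0\<close> that by (subst pos_le_divide_eq) (auto simp: algebra_simps)
    qed
    moreover have "\<forall>\<^sub>F n in sequentially. exp (u + real n * t) > 2 * C / (k * (exp (v - u) - 1))"
      using filterlim_compose[OF exp_at_top big[of u]] by (simp add: filterlim_at_top_dense)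
    ultimately have "\<forall>\<^sub>F n in sequentially. False" by eventually_elim simp
    then show False by simp
  qed
  have "h ((u + v) / 2) < (h u + h v) / 2" if "u \<noteq> v" for u v
  proof -
    define m where "m = (u + v) / 2"
    have "h (u + t) \<noteq> h (v + t)"
      using inj[of "u + t" "v + t"] inj[of "v + t" "u + t"] that by fastforce
    then have less: "half_ln_cosh ((h (u + t) + h (v + t)) / 2) < (h u + h v) / 2"
      using half_ln_cosh_strictly_convex unfolding strictly_convex_def rec[of u] rec[of v] by blast
    have "(u + t + (v + t)) / 2 = m + t" by (simp add: m_def field_simps)
    then have "h (m + t) \<le> (h (u + t) + h (v + t)) / 2"
      using convex_on_midpoint[OF conv, of "u + t" "v + t"] by metis
    then have "half_ln_cosh (h (m + t)) \<le> half_ln_cosh ((h (u + t) + h (v + t)) / 2)"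
      by (intro mono less_imp_le[OF pos])
    with less show ?thesis using rec[of m] by (simp add: m_def)
  qed
  with conv show ?thesis by (simp add: strictly_convex_def)
qed

section \<open>Products of rescaled log-concave functions\<close>

text \<open>
  The graph at the midpoint lies above both tangents but strictly below the chord.
\<close>

lemma strictly_convex_derivative_strict_mono:
  assumes G: "strictly_convex G" and der: "\<And>u. (G has_real_derivative G' u) (at u)" and "u < v"
  shows "G' u < G' v"
proof -
  define m where "m = (u + v) / 2"
  have tangent: "G' x * (m - x) \<le> G m - G x" for x
    using G der by (intro convex_on_imp_above_tangent[of UNIV]) (auto simp: strictly_convex_def)
  have "G m < (G u + G v) / 2"
    using G \<open>u < v\<close> by (simp add: strictly_convex_def m_def)
  then have "G' u * (m - u) + G' v * (m - v) < 0"
    using tangent[of u] tangent[of v] by argo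
  moreover have "m - u = (v - u) / 2" "m - v = - ((v - u) / 2)"
    by (simp_all add: m_def field_simps)
  ultimately have "G' u * ((v - u) / 2) < G' v * ((v - u) / 2)"
    by simp
  then show ?thesis using \<open>u < v\<close> by (simp add: mult_less_cancel_right)
qed

definition strictly_log_concave_in_log :: "(real \<Rightarrow> real) \<Rightarrow> bool" where
  "strictly_log_concave_in_log \<phi> \<longleftrightarrow>
    (\<forall>x>0. \<phi> x > 0 \<and> \<phi> differentiable (at x)) \<and> strictly_convex (\<lambda>u. - ln (\<phi> (exp u)))"

definition strictly_peaked_at_0 :: "(real \<Rightarrow> real) \<Rightarrow> bool" where
  "strictly_peaked_at_0 f \<longleftrightarrow>
    (\<forall>t. f differentiable (at t)) \<and> deriv f 0 = 0 \<and> (\<forall>t<0. deriv f t > 0) \<and> (\<forall>t>0. deriv f t < 0) \<and>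
    (\<forall>t. t \<noteq> 0 \<longrightarrow> f t < f 0) \<and> (\<forall>t. (\<forall>\<^sub>F s in at t. f s < f t) \<longrightarrow> t = 0)"

lemma strictly_peaked_at_0I:
  assumes der: "\<And>t. (f has_real_derivative f' t) (at t)"
    and "f' 0 = 0" "\<And>t. t < 0 \<Longrightarrow> f' t > 0" "\<And>t. t > 0 \<Longrightarrow> f' t < 0"
  shows "strictly_peaked_at_0 f"
proof -
  have cont: "continuous_on A f" for A
    using der by (intro DERIV_continuous_on) (auto intro: has_field_derivative_at_within)
  have max: "f t < f 0" if "t \<noteq> 0" for t
  proof (cases "t < 0")
    case True
    then show ?thesis
      by (rule DERIV_pos_imp_increasing_open) (use der assms(3) cont in blast)+
  next
    case False
    then have "0 < t" using that by simp
    then show ?thesis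
      by (rule DERIV_neg_imp_decreasing_open) (use der assms(4) cont in blast)+
  qed
  have local: "t = 0" if "\<forall>\<^sub>F s in at t. f s < f t" for t
  proof -
    from that obtain d where d: "d > 0" "\<And>s. s \<noteq> t \<Longrightarrow> dist s t < d \<Longrightarrow> f s < f t"
      by (auto simp: eventually_at)
    have "f' t = 0"
      using d by (intro DERIV_local_max[OF der d(1)]) (metis abs_minus_commute dist_real_def less_eq_real_def)
    then show ?thesis using assms(3)[of t] assms(4)[of t] by (cases t "0::real" rule: linorder_cases) auto
  qed
  have "deriv f t = f' t" for t by (rule DERIV_imp_deriv[OF der])
  moreover have "f differentiable (at t)" for t
    using der by (auto simp: real_differentiable_def)
  ultimately show ?thesis
    unfolding strictly_peaked_at_0_def using assms max local by auto
qed

text \<open>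
  The sign of the logarithmic derivative is decided term by term by the monotonicity of \<open>G'\<close>,
  the comparison sum \<open>G' (ln \<alpha>) \<Sum>\<^sub>i ln c\<^sub>i\<close> being zero. An index with \<open>c\<^sub>i \<noteq> 1\<close> makes the
  comparison strict.
\<close>

lemma prod_scaled_strictly_peaked_at_0:
  fixes c :: "real ^ 'n"
  assumes \<phi>: "strictly_log_concave_in_log \<phi>" and "\<alpha> > 0" and c: "\<And>i. c $ i > 0"
    and prod1: "(\<Prod>i\<in>UNIV. c $ i) = 1" and ne: "\<not> (\<forall>i. c $ i = 1)"
  shows "strictly_peaked_at_0 (\<lambda>t. \<Prod>i\<in>UNIV. \<phi> ((c $ i) powr t * \<alpha>))"
proof -
  define G where "G = (\<lambda>u. - ln (\<phi> (exp u)))"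
  define G' where "G' = deriv G"
  define l where "l = (\<lambda>i. ln (c $ i))"
  define a where "a = ln \<alpha>"
  define S where "S = (\<lambda>t. \<Sum>i\<in>UNIV. G' (t * l i + a) * l i)"
  have G: "strictly_convex G" and pos: "\<And>x. x > 0 \<Longrightarrow> \<phi> x > 0"
    and diff: "\<And>x. x > 0 \<Longrightarrow> \<phi> differentiable (at x)"
    using \<phi> by (auto simp: strictly_log_concave_in_log_def G_def)
  have der: "(G has_real_derivative G' u) (at u)" for u
  proof -
    obtain D where "(\<phi> has_real_derivative D) (at (exp u))"
      using diff[of "exp u"] by (auto simp: real_differentiable_def)
    from DERIV_chain2[OF this DERIV_exp]
    have "((\<lambda>u. \<phi> (exp u)) has_real_derivative D * exp u) (at u)" .
    from DERIV_minus[OF DERIV_chain2[OF DERIV_ln[OF pos[of "exp u"]] this]]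
    have "(G has_real_derivative - (inverse (\<phi> (exp u)) * (D * exp u))) (at u)"
      by (simp add: G_def)
    then show ?thesis unfolding G'_def by (metis DERIV_imp_deriv)
  qed
  have mono: "G' u < G' v" if "u < v" for u v
    by (rule strictly_convex_derivative_strict_mono[OF G der that])
  have arg: "exp (t * l i + a) = (c $ i) powr t * \<alpha>" for t i
    using c[of i] \<open>\<alpha> > 0\<close> by (simp add: exp_add powr_def l_def a_def)
  have phi_eq: "\<phi> ((c $ i) powr t * \<alpha>) = exp (- G (t * l i + a))" for i t
    using pos[of "(c $ i) powr t * \<alpha>"] c[of i] \<open>\<alpha> > 0\<close> by (simp add: G_def arg)
  have sum0: "(\<Sum>i\<in>UNIV. l i) = 0"
    using ln_prod[of UNIV "\<lambda>i. c $ i"] c prod1 by (simp add: l_def less_imp_neq[symmetric])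
  have "\<exists>j. l j \<noteq> 0"
    using ne c by (auto simp: l_def)
  then obtain j where j: "l j \<noteq> 0" by blast
  have S0: "S 0 = 0"
    by (simp add: S_def sum0 flip: sum_distrib_left)
  have Spos: "S t > 0" if "t > 0" for t
  proof -
    have less: "G' a * l i < G' (t * l i + a) * l i" if "l i \<noteq> 0" for i
      using that mono[of a "t * l i + a"] mono[of "t * l i + a" a] \<open>t > 0\<close>
      by (cases "l i > 0") (auto simp: mult_less_cancel_right mult_pos_neg)
    have "(\<Sum>i\<in>UNIV. G' a * l i) < S t"
      unfolding S_def
    proof (rule sum_strict_mono_ex1)
      show "\<forall>i\<in>UNIV. G' a * l i \<le> G' (t * l i + a) * l i"
        using less by (metis less_eq_real_def mult_zero_right)
      show "\<exists>i\<in>UNIV. G' a * l i < G' (t * l i + a) * l i"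
        using less[OF j] by blast
    qed simp
    then show ?thesis by (simp add: sum0 flip: sum_distrib_left)
  qed
  have Sneg: "S t < 0" if "t < 0" for t
  proof -
    have less: "G' (t * l i + a) * l i < G' a * l i" if "l i \<noteq> 0" for i
      using that mono[of a "t * l i + a"] mono[of "t * l i + a" a] \<open>t < 0\<close>
      by (cases "l i > 0") (auto simp: mult_less_cancel_right mult_neg_pos mult_neg_neg)
    have "S t < (\<Sum>i\<in>UNIV. G' a * l i)"
      unfolding S_def
    proof (rule sum_strict_mono_ex1)
      show "\<forall>i\<in>UNIV. G' (t * l i + a) * l i \<le> G' a * l i"
        using less by (metis less_eq_real_def mult_zero_right)
      show "\<exists>i\<in>UNIV. G' (t * l i + a) * l i < G' a * l i"
        using less[OF j] by blast
    qed simp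
    then show ?thesis by (simp add: sum0 flip: sum_distrib_left)
  qed
  have f_eq: "(\<lambda>t. \<Prod>i\<in>UNIV. \<phi> ((c $ i) powr t * \<alpha>)) = (\<lambda>t. exp (- (\<Sum>i\<in>UNIV. G (t * l i + a))))"
    by (simp add: phi_eq exp_sum sum_negf[symmetric])
  show ?thesis
    unfolding f_eq
  proof (rule strictly_peaked_at_0I)
    fix t
    have "((\<lambda>t. G (t * l i + a)) has_real_derivative G' (t * l i + a) * l i) (at t)" for i
      by (rule DERIV_chain2[OF der]) (auto intro!: derivative_eq_intros)
    then have "((\<lambda>t. \<Sum>i\<in>UNIV. G (t * l i + a)) has_real_derivative S t) (at t)"
      unfolding S_def by (intro DERIV_sum)
    from DERIV_chain2[OF DERIV_exp DERIV_minus[OF this]]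
    show "((\<lambda>t. exp (- (\<Sum>i\<in>UNIV. G (t * l i + a)))) has_real_derivative
      exp (- (\<Sum>i\<in>UNIV. G (t * l i + a))) * - S t) (at t)" .
  qed (use S0 Spos Sneg in \<open>auto simp: mult_less_0_iff zero_less_mult_iff\<close>)
qed

section \<open>Log-concavity of the theta functions\<close>

lemma thetas_differentiable:
  assumes "x > 0"
  shows "theta2 differentiable (at x)" "theta3 differentiable (at x)" "theta4 differentiable (at x)"
  using assms by (auto simp: theta2_eq theta3_eq theta4_eq intro!: theta_differentiable)

lemma neg_ln_ratio23_recurrence:
  "- ln (ratio23 (exp u)) = half_ln_cosh (- ln (ratio23 (exp (u + ln 2))))"
proof -
  define q where "q = ratio23 (exp (u + ln 2))"
  have q: "q > 0" unfolding q_def by (rule ratio_pos) simp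
  have "exp (u + ln 2) / 2 = exp u" by (simp add: exp_add)
  then have "(ratio23 (exp u))\<^sup>2 = 2 * q / (1 + q\<^sup>2)"
    using ratio23_half[of "exp (u + ln 2)"] by (simp add: q_def)
  also have "\<dots> = 1 / cosh (- ln q)"
    using q by (simp add: cosh_ln_real field_simps power2_eq_square)
  finally have "ln ((ratio23 (exp u))\<^sup>2) = ln (1 / cosh (- ln q))" by simp
  then have "2 * ln (ratio23 (exp u)) = - ln (cosh (- ln q))"
    using ratio_pos(2)[of "exp u"] by (simp add: ln_realpow ln_div)
  then show ?thesis by (simp add: half_ln_cosh_def q_def)
qed

text \<open>
  The terms \<open>k = 0\<close> and \<open>k = - 1\<close> dominate \<open>\<theta>\<^sub>2\<close>, with exponent \<open>- \<pi>x/4\<close>, while \<open>\<theta>\<^sub>3\<close> stays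
  between \<open>1\<close> and its value at \<open>1\<close>.
\<close>

lemma neg_ln_ratio23_asymp:
  obtains C where "\<And>u. u \<ge> 0 \<Longrightarrow> \<bar>- ln (ratio23 (exp u)) - pi / 4 * exp u\<bar> \<le> C"
proof
  fix u :: real assume "u \<ge> 0"
  define x where "x = exp u"
  have x: "x \<ge> 1" "x > 0" using \<open>u \<ge> 0\<close> by (auto simp: x_def)
  note pos = theta2_pos[OF x(2)] theta3_pos[OF x(2)]
  have t2: "theta2 x \<le> exp (- pi * (1/4) * (x - 1)) * theta2 1"
    unfolding theta2_eq theta_def
  proof -
    have "(1/4 :: real) \<le> (of_int k + 1/2)\<^sup>2" for k :: int
    proof -
      have "0 \<le> k * (k + 1)" by (auto simp: zero_le_mult_iff)
      then have "(0::real) \<le> of_int (k * (k + 1))" by linarith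
      then show ?thesis by (simp add: power2_eq_square algebra_simps)
    qed
    then show "(\<Sum>\<^sub>\<infinity>k. 1 powi k * exp (- pi * (real_of_int k + 1 / 2)\<^sup>2 * x)) \<le>
      exp (- pi * (1 / 4) * (x - 1)) * (\<Sum>\<^sub>\<infinity>k. 1 powi k * exp (- pi * (real_of_int k + 1 / 2)\<^sup>2 * 1))"
      using gaussian_sum_exp_decay[OF x(1), of UNIV "1/4" "1/2"] by (simp add: theta_def)
  qed
  have t3: "theta3 x \<le> theta3 1"
    using gaussian_sum_exp_decay[OF x(1), of UNIV 0 0] by (simp add: theta3_eq theta_def)
  have ln_q: "ln (ratio23 x) = ln (theta2 x) - ln (theta3 x)"
    using pos by (simp add: ratio23_def ln_div)
  have "ln (theta2 x) \<le> ln (exp (- pi * (1/4) * (x - 1)) * theta2 1)"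
    using t2 pos by (subst ln_le_cancel_iff) (auto simp: theta2_pos)
  also have "\<dots> = - pi * (1/4) * (x - 1) + ln (theta2 1)"
    by (subst ln_mult) (use theta2_pos[of 1] in auto)
  finally have "ln (theta2 x) \<le> - (pi / 4 * x) + (pi / 4 + ln (theta2 1))"
    by (simp add: algebra_simps diff_divide_distrib)
  moreover have "- pi * x / 4 \<le> ln (theta2 x)"
    using theta2_ge[OF x(2)] pos by (simp add: ln_ge_iff)
  moreover have "0 \<le> ln (theta3 x)" "ln (theta3 x) \<le> ln (theta3 1)"
    using t3 theta3_ge_1[OF x(2)] pos by auto
  ultimately have "\<bar>- ln (ratio23 x) - pi / 4 * x\<bar> \<le> \<bar>pi / 4 + ln (theta2 1)\<bar> + ln (theta3 1)"
    unfolding ln_q by (intro abs_leI) (auto simp: algebra_simps)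
  then show "\<bar>- ln (ratio23 (exp u)) - pi / 4 * exp u\<bar> \<le> \<bar>pi / 4 + ln (theta2 1)\<bar> + ln (theta3 1)"
    by (simp add: x_def)
qed

lemma neg_ln_ratio23_strictly_convex: "strictly_convex (\<lambda>u. - ln (ratio23 (exp u)))"
proof -
  obtain C where "\<And>u. u \<ge> 0 \<Longrightarrow> \<bar>- ln (ratio23 (exp u)) - pi / 4 * exp u\<bar> \<le> C"
    using neg_ln_ratio23_asymp by blast
  then show ?thesis
    by (intro strictly_convex_cosh_recurrence[where t = "ln 2" and k = "pi / 4" and C = C]
        neg_ln_ratio23_recurrence)
      (auto simp: ratio_less_1 ratio_pos)
qed

text \<open>
  By \<open>\<theta>\<^sub>4 (2x)\<^sup>2 = \<theta>\<^sub>3 x \<theta>\<^sub>4 x\<close>, the difference of \<open>- ln \<theta>\<^sub>4\<close> at \<open>x\<close> and \<open>2x\<close> is \<open>- ln (\<theta>\<^sub>4/\<theta>\<^sub>3)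
  / 2\<close> at \<open>x\<close>, which the functional equation identifies with a reflection of \<open>- ln (\<theta>\<^sub>2/\<theta>\<^sub>3)\<close>.
\<close>

lemma neg_ln_theta4_strictly_convex: "strictly_convex (\<lambda>u. - ln (theta4 (exp u)))"
proof (rule strictly_convex_telescope)
  show "strictly_convex (\<lambda>u. - ln (ratio43 (exp u)) / 2)"
    using strictly_convex_affine[OF neg_ln_ratio23_strictly_convex, of "1/2" "-1" 0 0 0]
    by (simp add: ratio_modular exp_minus inverse_eq_divide)
  fix u :: real
  let ?x = "exp u"
  have "ln (theta3 ?x * theta4 ?x) = ln ((theta4 (2 * ?x))\<^sup>2)"
    by (simp add: theta3_theta4)
  then have "ln (theta3 ?x) + ln (theta4 ?x) = 2 * ln (theta4 (2 * ?x))"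
    using theta3_pos[of ?x] theta4_pos[of ?x] theta4_pos[of "2 * ?x"]
    by (simp add: ln_mult ln_realpow)
  moreover have "ln (ratio43 ?x) = ln (theta4 ?x) - ln (theta3 ?x)"
    using theta3_pos[of ?x] theta4_pos[of ?x] by (simp add: ratio43_def ln_div)
  ultimately show "- ln (theta4 (exp u)) = - ln (theta4 (exp (u + ln 2))) + - ln (ratio43 (exp u)) / 2"
    by (simp add: exp_add mult.commute diff_divide_distrib)
  have "exp (u + real n * ln 2) = 2 ^ n * exp u" for n
    by (simp add: exp_add exp_of_nat_mult mult.commute)
  moreover have "(\<lambda>n. - ln (theta4 (2 ^ n * exp u))) \<longlonglongrightarrow> - ln 1"
    unfolding theta4_eq
    by (intro tendsto_minus tendsto_ln filterlim_compose[OF theta_0_tendsto_1 filterlim_doubling]) auto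
  ultimately show "(\<lambda>n. - ln (theta4 (exp (u + real n * ln 2)))) \<longlonglongrightarrow> 0" by simp
qed

text \<open>
  The functional equation turns \<open>\<theta>\<^sub>2\<close> into \<open>\<theta>\<^sub>4\<close> at the reflected logarithm, up to the factor
  \<open>x\<^sup>-\<^sup>1\<^sup>/\<^sup>2\<close>, which is affine after taking logarithms.
\<close>

lemma neg_ln_theta2_strictly_convex: "strictly_convex (\<lambda>u. - ln (theta2 (exp u)))"
proof -
  have "- ln (theta2 (exp u)) = 1 * - ln (theta4 (exp (- 1 * u + 0))) + (1/2 * u + 0)" for u
  proof -
    have sqrt_exp: "sqrt (exp (- u)) = exp (- u / 2)"
      by (rule real_sqrt_unique) (simp_all add: power2_eq_square flip: exp_add)
    have inv: "1 / exp (- u) = exp u" by (simp add: exp_minus divide_inverse)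
    have "theta2 (exp u) = exp (- u / 2) * theta4 (exp (- u))"
      using theta2_modular[OF exp_gt_zero, of "- u"] unfolding inv sqrt_exp .
    then show ?thesis
      using theta4_pos[of "exp (- u)"] by (simp add: ln_mult)
  qed
  then show ?thesis
    using strictly_convex_affine[OF neg_ln_theta4_strictly_convex, of 1 "-1" 0 "1/2" 0] by simp
qed

lemma theta4_log_concave: "strictly_log_concave_in_log theta4"
  by (simp add: strictly_log_concave_in_log_def neg_ln_theta4_strictly_convex theta4_pos thetas_differentiable)

lemma theta2_log_concave: "strictly_log_concave_in_log theta2"
  by (simp add: strictly_log_concave_in_log_def neg_ln_theta2_strictly_convex theta2_pos thetas_differentiable)

lemma theta2_div_theta3_log_concave: "strictly_log_concave_in_log (\<lambda>x. theta2 x / theta3 x)"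
  using neg_ln_ratio23_strictly_convex
  by (simp add: strictly_log_concave_in_log_def ratio23_def theta2_pos theta3_pos thetas_differentiable
      less_imp_neq[OF theta3_pos, symmetric])

lemma theta3_theta4_log_concave: "strictly_log_concave_in_log (\<lambda>x. theta3 x * theta4 x)"
  unfolding strictly_log_concave_in_log_def
proof (intro conjI allI impI)
  have "- ln (theta3 (exp u) * theta4 (exp u)) = 2 * - ln (theta4 (exp (1 * u + ln 2))) + (0 * u + 0)" for u
    using theta4_pos[of "2 * exp u"] by (simp add: theta3_theta4 ln_realpow exp_add mult.commute)
  then show "strictly_convex (\<lambda>u. - ln (theta3 (exp u) * theta4 (exp u)))"
    using strictly_convex_affine[OF neg_ln_theta4_strictly_convex, of 2 1 "ln 2" 0 0] by simp
qed (simp_all add: theta3_pos theta4_pos thetas_differentiable)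

lemma theta2_theta3_log_concave: "strictly_log_concave_in_log (\<lambda>x. theta2 x * theta3 x)"
  unfolding strictly_log_concave_in_log_def
proof (intro conjI allI impI)
  have "- ln (theta2 (exp u) * theta3 (exp u)) = 2 * - ln (theta2 (exp (1 * u + - ln 2))) + (0 * u + ln 2)" for u
  proof -
    have "theta2 (exp u) * theta3 (exp u) = (theta2 (exp u / 2))\<^sup>2 / 2"
      using theta2_sq[of "exp u / 2"] by simp
    then show ?thesis
      using theta2_pos[of "exp u / 2"] unfolding \<open>theta2 (exp u) * theta3 (exp u) = _\<close>
      by (simp add: ln_div ln_realpow exp_diff)
  qed
  then show "strictly_convex (\<lambda>u. - ln (theta2 (exp u) * theta3 (exp u)))"
    using strictly_convex_affine[OF neg_ln_theta2_strictly_convex, of 2 1 "- ln 2" 0 "ln 2"] by simp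
qed (simp_all add: theta2_pos theta3_pos thetas_differentiable)

section \<open>Theta series of lattices and the theorem\<close>

text \<open>
  The squared norm is a sum over coordinates, so the exponential factors and the sum over the
  lattice becomes a product of one-dimensional sums.
\<close>

lemma theta_set_diag_shifted_lattice:
  fixes b :: "'n::finite \<Rightarrow> real"
  assumes "\<alpha> > 0" and b: "\<And>i. b i > 0"
  shows "theta_set ((*v) (diag_matrix b) ` {x. \<forall>i. \<exists>k::int. x $ i = of_int k + s}) \<alpha> =
    (\<Prod>i\<in>UNIV. theta s 1 ((b i)\<^sup>2 * \<alpha>))"
proof -
  define H where "H = (\<lambda>g::'n \<Rightarrow> int. (\<chi> i. b i * (of_int (g i) + s)) :: real ^ 'n)"
  have mv: "diag_matrix b *v x = (\<chi> i. b i * x $ i)" for x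
    by (simp add: diag_matrix_def matrix_vector_mult_def vec_eq_iff if_distrib[of "\<lambda>y. y * _"] sum.delta cong: if_cong)
  have "(*v) (diag_matrix b) ` {x. \<forall>i. \<exists>k::int. x $ i = of_int k + s} = range H"
  proof (intro equalityI subsetI)
    fix y assume "y \<in> (*v) (diag_matrix b) ` {x. \<forall>i. \<exists>k::int. x $ i = of_int k + s}"
    then obtain x where x: "y = diag_matrix b *v x" "\<forall>i. \<exists>k::int. x $ i = of_int k + s" by auto
    from x(2) obtain g :: "'n \<Rightarrow> int" where "\<And>i. x $ i = of_int (g i) + s" by metis
    then have "y = H g" by (simp add: x(1) mv H_def)
    then show "y \<in> range H" by simp
  next
    fix y assume "y \<in> range H"
    then obtain g where "y = H g" by auto
    then have "y = diag_matrix b *v (\<chi> i. of_int (g i) + s)" by (simp add: mv H_def)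
    then show "y \<in> (*v) (diag_matrix b) ` {x. \<forall>i. \<exists>k::int. x $ i = of_int k + s}" by auto
  qed
  moreover have "inj H"
    using b by (auto simp: inj_def H_def vec_eq_iff fun_eq_iff less_imp_neq[symmetric])
  ultimately have "theta_set ((*v) (diag_matrix b) ` {x. \<forall>i. \<exists>k::int. x $ i = of_int k + s}) \<alpha> =
      (\<Sum>\<^sub>\<infinity>g\<in>UNIV. exp (- pi * \<alpha> * (norm (H g))\<^sup>2))"
    unfolding theta_set_def by (simp add: infsum_reindex o_def)
  also have "\<dots> = (\<Sum>\<^sub>\<infinity>g\<in>PiE UNIV (\<lambda>_. UNIV). \<Prod>i\<in>UNIV. exp (- pi * (of_int (g i) + s)\<^sup>2 * ((b i)\<^sup>2 * \<alpha>)))"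
  proof (rule infsum_cong_neutral)
    fix g :: "'n \<Rightarrow> int"
    have "(norm (H g))\<^sup>2 = (\<Sum>i\<in>UNIV. (b i * (of_int (g i) + s))\<^sup>2)"
      unfolding power2_norm_eq_inner inner_vec_def by (simp add: H_def power2_eq_square)
    then have "- pi * \<alpha> * (norm (H g))\<^sup>2 = (\<Sum>i\<in>UNIV. - pi * (of_int (g i) + s)\<^sup>2 * ((b i)\<^sup>2 * \<alpha>))"
      by (simp add: sum_distrib_left power_mult_distrib mult_ac)
    then show "exp (- pi * \<alpha> * (norm (H g))\<^sup>2) = (\<Prod>i\<in>UNIV. exp (- pi * (of_int (g i) + s)\<^sup>2 * ((b i)\<^sup>2 * \<alpha>)))"
      by (simp only: exp_sum finite)
  qed (auto simp: PiE_def)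
  also have "\<dots> = (\<Prod>i\<in>UNIV. \<Sum>\<^sub>\<infinity>k::int. exp (- pi * (of_int k + s)\<^sup>2 * ((b i)\<^sup>2 * \<alpha>)))"
  proof (rule infsum_prod_PiE_abs)
    fix i
    have "(b i)\<^sup>2 * \<alpha> > 0" using b[of i] \<open>\<alpha> > 0\<close> by simp
    from theta_abs_summable[OF this, of 1 s]
    show "(\<lambda>k::int. norm (exp (- pi * (of_int k + s)\<^sup>2 * ((b i)\<^sup>2 * \<alpha>)))) summable_on UNIV" by simp
  qed simp
  finally show ?thesis by (simp add: theta_def)
qed

lemma powr_half_sq: "(x powr (t / 2))\<^sup>2 = x powr t" if "x > (0::real)"
  using that by (simp add: power2_eq_square flip: powr_add)

theorem theorem1p4:
  fixes \<alpha> :: real and c :: "real ^ 'n"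
  assumes "\<alpha> > 0"
    and "\<And>i. c $ i > 0"
    and "(\<Prod>i\<in>UNIV. c $ i) = 1"
    and "\<not> (\<forall>i. c $ i = 1)"
  shows "(\<forall>t. U2 \<alpha> c t = (\<Prod>i\<in>UNIV. theta2 ((c $ i) powr t * \<alpha>))) \<and>
         (\<forall>t. Q \<alpha> c t =
           (\<Prod>i\<in>UNIV. theta2 ((c $ i) powr t * \<alpha>) / theta3 ((c $ i) powr t * \<alpha>))) \<and>
         (\<forall>f \<in> {U4 \<alpha> c, U2 \<alpha> c, Q \<alpha> c, P34 \<alpha> c, P23 \<alpha> c}.
           (\<forall>t. f differentiable (at t)) \<and>
           deriv f 0 = 0 \<and>
           (\<forall>t<0. deriv f t > 0) \<and>
           (\<forall>t>0. deriv f t < 0) \<and>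
           (\<forall>t. t \<noteq> 0 \<longrightarrow> f t < f 0) \<and>
           (\<forall>t. (\<forall>\<^sub>F s in at t. f s < f t) \<longrightarrow> t = 0))"
proof -
  have half: "theta_set ((*v) (A_mat c t) ` half_int_lattice) \<alpha> = (\<Prod>i\<in>UNIV. theta2 ((c $ i) powr t * \<alpha>))" for t
    using theta_set_diag_shifted_lattice[OF assms(1), of "\<lambda>i. (c $ i) powr (t / 2)" "1/2"] assms(2)
    by (simp add: A_mat_def half_int_lattice_def theta2_eq powr_half_sq less_imp_neq[symmetric])
  have "int_lattice = {x :: real ^ 'n. \<forall>i. \<exists>k::int. x $ i = of_int k + 0}"
    by (auto simp: int_lattice_def Ints_def)
  then have int: "theta_set ((*v) (A_mat c t) ` int_lattice) \<alpha> = (\<Prod>i\<in>UNIV. theta3 ((c $ i) powr t * \<alpha>))" for t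
    using theta_set_diag_shifted_lattice[OF assms(1), of "\<lambda>i. (c $ i) powr (t / 2)" 0] assms(2)
    by (simp add: A_mat_def theta3_eq powr_half_sq less_imp_neq[symmetric])
  have U2: "U2 \<alpha> c = (\<lambda>t. \<Prod>i\<in>UNIV. theta2 ((c $ i) powr t * \<alpha>))"
    by (simp add: fun_eq_iff U2_def half)
  have Q: "Q \<alpha> c = (\<lambda>t. \<Prod>i\<in>UNIV. theta2 ((c $ i) powr t * \<alpha>) / theta3 ((c $ i) powr t * \<alpha>))"
    by (simp add: fun_eq_iff Q_def half int prod_dividef)
  note peaked = prod_scaled_strictly_peaked_at_0[OF _ assms]
  have "strictly_peaked_at_0 f" if "f \<in> {U4 \<alpha> c, U2 \<alpha> c, Q \<alpha> c, P34 \<alpha> c, P23 \<alpha> c}" for f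
    using that peaked[OF theta4_log_concave] peaked[OF theta2_log_concave]
      peaked[OF theta2_div_theta3_log_concave] peaked[OF theta3_theta4_log_concave]
      peaked[OF theta2_theta3_log_concave]
    by (auto simp: U2 Q U4_def[abs_def] P34_def[abs_def] P23_def[abs_def])
  then show ?thesis
    unfolding U2 Q strictly_peaked_at_0_def by blast
qed

end
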